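(* Let $X=\{0,1\}^{\mathbf N}$ with the natural product probability measure $\mu$, and let $E$ be a sofic countable measured equivalence relation on $(X,\mu)$. Then the measurable full group $[E]$ is a sofic group.
   Context: Sofic groups. For a finite nonempty set $A$, $Map(A)$ is the set of all maps $A\to A$ (with composition), and $d_H(\alpha,\beta)=\frac{|\{x\in A : \alpha(x)\ne\beta(x)\}|}{|A|}$ for $\alpha,\beta\in Map(A)$. A group $\Gamma$ is sofic if for every finite set $F\subset\Gamma$ and every $\epsilon>0$ there exist a finite nonempty set $A$ and a map $\Theta:\Gamma\to Map(A)$ such that: (i) if $f,g,fg\in F$ then $d_H(\Theta(fg),\Theta(f)\Theta(g))\le\epsilon$; (ii) if $1\ne f\in F$ then $d_H(\Theta(f),1)>1-\epsilon$; (iii) $\Theta(1)=1$ (the identity map). Labeled balls. Let $\mathbf F_\infty$ be the free group on $\gamma_1,\gamma_2,\dots$ and $\mathbf F_r\le\mathbf F_\infty$ the free group on $\gamma_1,\dots,\gamma_r$. Suppose $\mathbf F_r$ acts on a set $Y$ and each point of $Y$ carries a label in $\{0,1\}^r$. For $y\in Y$ and $k\ge1$, the $k$-ball $B_k(y)$ is the finite rooted graph with root $y$, whose vertices are the points $w(y)$ with $w\in\mathbf F_r$ a reduced word of length at most $k$, with the vertex labels inherited from $Y$, and in which each directed edge $(u,v)$ (possibly a loop) is labeled by the set of all $s\in\{\gamma_1,\gamma_1^{-1},\dots,\gamma_r,\gamma_r^{-1}\}$ with $s(u)=v$ (there is an edge exactly when this set is nonempty). $U_r^k$ is the finite set of isomorphism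 classes (as rooted, vertex- and edge-labeled graphs) of $k$-balls arising in this way. Sofic actions and relations. Let $\Phi:\mathbf F_\infty\curvearrowright X$ be a (not necessarily free) Borel action preserving $\mu$. For $r\ge1$ restrict it to $\mathbf F_r$ and label each $x\in X$ by its first $r$ coordinates; for $\kappa\in U_r^k$ let $\mu^k_{\Phi_r}(\kappa)$ be the $\mu$-probability that the $k$-ball around $x\in X$ is isomorphic to $\kappa$. For an action $\alpha$ of $\mathbf F_r$ on a finite nonempty set $Y$ with a labeling of $Y$ by elements of $\{0,1\}^r$, let $\mu_\alpha^{k,r}(\kappa)$ be the proportion of points $y\in Y$ whose $k$-ball is isomorphic to $\kappa$. The action $\Phi$ is sofic if for every $r\ge1$ there is a sequence $\{\alpha_n\}_{n\ge1}$ of such $\{0,1\}^r$-labeled finite $\mathbf F_r$-actions with $\lim_{n\to\infty}\mu^{k,r}_{\alpha_n}(\kappa)=\mu^k_{\Phi_r}(\kappa)$ for every $k\ge1$ and every $\kappa\in U_r^k$. The countable measured equivalence relation $E_\Phi$ is defined by $x\sim y$ iff $w(x)=y$ for some $w\in\mathbf F_\infty$. A countable measured equivalence relation $E$ on $(X,\mu)$ is sofic if $E=E_\Phi$ for a sofic action $\Phi$. Full group. $[E]_B$ is the group of all Borel bijections $T:X\to X$ with $T(x)\sim_E x$ for all $x\in X$. The measurable full group is $[E]=[E]_B/N$, where $N$ is the normal subgroup of those elements fixing $\mu$-almost every point. *)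

theory Defs
  imports "HOL-Probability.Probability" "HOL-Algebra.Group_Action"
begin

section \<open>Sofic groups\<close>

definition hamming_dist :: "'x set \<Rightarrow> ('x \<Rightarrow> 'x) \<Rightarrow> ('x \<Rightarrow> 'x) \<Rightarrow> real" where
  "hamming_dist A \<alpha> \<beta> = real (card {x \<in> A. \<alpha> x \<noteq> \<beta> x}) / real (card A)"

text \<open>The monoid of self-maps of \<open>A\<close> is \<open>A \<rightarrow>\<^sub>E A\<close> with \<^const>\<open>compose\<close>. Taking \<open>A\<close> to be
  a finite set of natural numbers loses no generality, since only the cardinality of \<open>A\<close> matters.\<close>

definition sofic_group :: "('g, 'b) monoid_scheme \<Rightarrow> bool" where
  "sofic_group G \<longleftrightarrow> group G \<and>
    (\<forall>F \<epsilon>. finite F \<longrightarrow> F \<subseteq> carrier G \<longrightarrow> (0::real) < \<epsilon> \<longrightarrow>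
      (\<exists>(A :: nat set) \<Theta>. finite A \<and> A \<noteq> {} \<and> \<Theta> \<in> carrier G \<rightarrow> (A \<rightarrow>\<^sub>E A) \<and>
        (\<forall>f\<in>F. \<forall>g\<in>F. f \<otimes>\<^bsub>G\<^esub> g \<in> F \<longrightarrow>
            hamming_dist A (\<Theta> (f \<otimes>\<^bsub>G\<^esub> g)) (compose A (\<Theta> f) (\<Theta> g)) \<le> \<epsilon>) \<and>
        (\<forall>f\<in>F. f \<noteq> \<one>\<^bsub>G\<^esub> \<longrightarrow> hamming_dist A (\<Theta> f) (\<lambda>x\<in>A. x) > 1 - \<epsilon>) \<and>
        \<Theta> \<one>\<^bsub>G\<^esub> = (\<lambda>x\<in>A. x)))"


section \<open>Free groups\<close>

text \<open>The letter \<open>(i, True)\<close> is the \<open>i\<close>-th free generator and \<open>(i, False)\<close> its inverse;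
  generators are numbered from \<open>0\<close>. The elements of a free group are its reduced words, and the
  product of \<open>u\<close> and \<open>v\<close> is the reduced form of \<open>u @ v\<close>.\<close>

type_synonym letter = "nat \<times> bool"

definition flip :: "letter \<Rightarrow> letter" where
  "flip s = (fst s, \<not> snd s)"

definition reduced :: "letter list \<Rightarrow> bool" where
  "reduced = successively (\<lambda>s t. t \<noteq> flip s)"

fun push :: "letter \<Rightarrow> letter list \<Rightarrow> letter list" where
  "push s [] = [s]"
| "push s (t # w) = (if t = flip s then w else s # t # w)"

definition free_group :: "nat set \<Rightarrow> letter list monoid" where
  "free_group I = \<lparr>carrier = {w. reduced w \<and> fst ` set w \<subseteq> I},
                   monoid.mult = (\<lambda>u v. foldr push u v),
                   one = []\<rparr>"

abbreviation free_group_inf :: "letter list monoid" where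
  "free_group_inf \<equiv> free_group UNIV"

abbreviation free_group_fin :: "nat \<Rightarrow> letter list monoid" where
  "free_group_fin r \<equiv> free_group {..<r}"

lemma flip_flip [simp]: "flip (flip s) = s"
  by (simp add: flip_def)

lemma fst_flip [simp]: "fst (flip s) = fst s"
  by (simp add: flip_def)

lemma flip_neq [simp]: "flip s \<noteq> s" "s \<noteq> flip s"
  by (cases s; simp add: flip_def)+

lemma reduced_Nil [simp]: "reduced []"
  by (simp add: reduced_def)

lemma reduced_Cons: "reduced (s # w) \<longleftrightarrow> reduced w \<and> (w = [] \<or> hd w \<noteq> flip s)"
  by (cases w) (auto simp: reduced_def)

lemma reduced_push: "reduced w \<Longrightarrow> reduced (push s w)"
  by (cases w) (auto simp: reduced_Cons)

lemma reduced_foldr_push: "reduced w \<Longrightarrow> reduced (foldr push u w)"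
  by (induction u) (auto simp: reduced_push)

lemma push_push_flip: "reduced w \<Longrightarrow> push s (push (flip s) w) = w"
  by (cases w; cases "tl w") (auto simp: reduced_Cons)

lemma foldr_push_push:
  assumes "reduced w"
  shows "foldr push (push s v) w = push s (foldr push v w)"
proof (cases v)
  case (Cons t v')
  have "push s (push (flip s) (foldr push v' w)) = foldr push v' w"
    by (intro push_push_flip reduced_foldr_push assms)
  with Cons show ?thesis by auto
qed auto

lemma foldr_push_assoc:
  "reduced w \<Longrightarrow> foldr push (foldr push u v) w = foldr push u (foldr push v w)"
  by (induction u) (auto simp: foldr_push_push)

lemma foldr_push_Nil: "reduced w \<Longrightarrow> foldr push w [] = w"
proof (induction w)
  case (Cons s w)
  then show ?case by (cases w) (auto simp: reduced_Cons)
qed auto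

lemma set_push: "set (push s w) \<subseteq> insert s (set w)"
  by (cases w) auto

lemma set_foldr_push: "set (foldr push u v) \<subseteq> set u \<union> set v"
  by (induction u) (use set_push in fastforce)+

lemma foldr_push_inverse: "foldr push (rev (map flip w)) w = []"
  by (induction w) auto

lemma reduced_inverse: "reduced w \<Longrightarrow> reduced (rev (map flip w))"
  unfolding reduced_def successively_rev successively_map
  by (erule successively_mono) auto

lemma group_free_group: "group (free_group I)"
proof (rule groupI)
  fix u v assume "u \<in> carrier (free_group I)" "v \<in> carrier (free_group I)"
  then show "u \<otimes>\<^bsub>free_group I\<^esub> v \<in> carrier (free_group I)"
    using set_foldr_push[of u v] by (fastforce simp: free_group_def reduced_foldr_push)
next
  fix u assume "u \<in> carrier (free_group I)"
  then have "rev (map flip u) \<in> carrier (free_group I)"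
    by (auto simp: free_group_def reduced_inverse)
  moreover have "rev (map flip u) \<otimes>\<^bsub>free_group I\<^esub> u = \<one>\<^bsub>free_group I\<^esub>"
    by (simp add: free_group_def foldr_push_inverse del: rev_map)
  ultimately show "\<exists>v\<in>carrier (free_group I). v \<otimes>\<^bsub>free_group I\<^esub> u = \<one>\<^bsub>free_group I\<^esub>"
    by blast
qed (auto simp: free_group_def foldr_push_assoc)


section \<open>Labeled balls\<close>

text \<open>The edge label \<open>elabel G u v\<close> is empty exactly when there is no edge from \<open>u\<close> to \<open>v\<close>.
  Values of \<open>vlabel\<close> and \<open>elabel\<close> outside \<open>verts\<close> are irrelevant; isomorphisms ignore them.\<close>

record 'v labeled_graph =
  verts :: "'v set"
  root :: 'v
  vlabel :: "'v \<Rightarrow> nat \<Rightarrow> bool"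
  elabel :: "'v \<Rightarrow> 'v \<Rightarrow> letter set"

definition labeled_iso :: "'v labeled_graph \<Rightarrow> 'w labeled_graph \<Rightarrow> bool" where
  "labeled_iso G H \<longleftrightarrow>
    (\<exists>f. bij_betw f (verts G) (verts H) \<and> f (root G) = root H \<and>
      (\<forall>u\<in>verts G. vlabel H (f u) = vlabel G u) \<and>
      (\<forall>u\<in>verts G. \<forall>v\<in>verts G. elabel H (f u) (f v) = elabel G u v))"

text \<open>Isomorphism classes are represented by their members with vertices in \<^typ>\<open>nat\<close>. Every
  finite graph has such a representative, so two finite graphs, possibly with vertices of
  different types, are isomorphic iff they have the same \<open>iso_class\<close>.\<close>

definition iso_class :: "'v labeled_graph \<Rightarrow> nat labeled_graph set" where
  "iso_class G = {H. labeled_iso G H}"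

lemma labeled_iso_refl: "labeled_iso G G"
  unfolding labeled_iso_def by (rule exI[of _ id]) auto

lemma labeled_iso_sym:
  assumes "labeled_iso G H" and r: "root G \<in> verts G"
  shows "labeled_iso H G"
proof -
  obtain f where f: "bij_betw f (verts G) (verts H)" "f (root G) = root H"
      "\<forall>u\<in>verts G. vlabel H (f u) = vlabel G u"
      "\<forall>u\<in>verts G. \<forall>v\<in>verts G. elabel H (f u) (f v) = elabel G u v"
    using assms(1) unfolding labeled_iso_def by (elim exE conjE)
  let ?g = "inv_into (verts G) f"
  have g: "bij_betw ?g (verts H) (verts G)"
    using f(1) by (rule bij_betw_inv_into)
  have fg: "f (?g v) = v" "?g v \<in> verts G" if "v \<in> verts H" for v
    using that f(1) g by (auto simp: bij_betw_inv_into_right bij_betw_apply)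
  have "?g (root H) = root G"
    using f(1,2) r by (metis bij_betw_inv_into_left)
  moreover have "\<forall>u\<in>verts H. vlabel G (?g u) = vlabel H u"
    using f(3) fg by metis
  moreover have "\<forall>u\<in>verts H. \<forall>v\<in>verts H. elabel G (?g u) (?g v) = elabel H u v"
    using f(4) fg by metis
  ultimately show ?thesis
    using g unfolding labeled_iso_def by (intro exI[of _ ?g] conjI)
qed

lemma labeled_iso_trans:
  assumes "labeled_iso G H" "labeled_iso H K"
  shows "labeled_iso G K"
proof -
  obtain f where f: "bij_betw f (verts G) (verts H)" "f (root G) = root H"
      "\<forall>u\<in>verts G. vlabel H (f u) = vlabel G u"
      "\<forall>u\<in>verts G. \<forall>v\<in>verts G. elabel H (f u) (f v) = elabel G u v"
    using assms(1) unfolding labeled_iso_def by (elim exE conjE)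
  obtain g where g: "bij_betw g (verts H) (verts K)" "g (root H) = root K"
      "\<forall>u\<in>verts H. vlabel K (g u) = vlabel H u"
      "\<forall>u\<in>verts H. \<forall>v\<in>verts H. elabel K (g u) (g v) = elabel H u v"
    using assms(2) unfolding labeled_iso_def by (elim exE conjE)
  have "f u \<in> verts H" if "u \<in> verts G" for u
    using f(1) that by (rule bij_betw_apply)
  then show ?thesis
    unfolding labeled_iso_def using f g
    by (intro exI[of _ "g \<circ> f"]) (auto intro: bij_betw_trans)
qed

lemma iso_class_eq_iff:
  assumes "finite (verts G)" "root G \<in> verts G" "root H \<in> verts H"
  shows "iso_class G = iso_class H \<longleftrightarrow> labeled_iso G H"
proof
  assume eq: "iso_class G = iso_class H"
  obtain f :: "_ \<Rightarrow> nat" where f: "inj_on f (verts G)"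
    using finite_imp_inj_to_nat_seg[OF assms(1)] by blast
  let ?i = "inv_into (verts G) f"
  let ?K = "\<lparr>verts = f ` verts G, root = f (root G), vlabel = (\<lambda>u. vlabel G (?i u)),
              elabel = (\<lambda>u v. elabel G (?i u) (?i v))\<rparr>"
  have "labeled_iso G ?K"
    unfolding labeled_iso_def using f by (intro exI[of _ f]) (auto simp: bij_betw_def)
  with eq have "labeled_iso H ?K"
    by (auto simp: iso_class_def)
  then show "labeled_iso G H"
    using labeled_iso_trans[OF \<open>labeled_iso G ?K\<close>] labeled_iso_sym assms(3) by blast
next
  assume "labeled_iso G H"
  moreover from this have "labeled_iso H G"
    using assms(2) by (rule labeled_iso_sym)
  ultimately show "iso_class G = iso_class H"
    unfolding iso_class_def by (intro Collect_cong iffI) (erule (1) labeled_iso_trans[rotated])+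
qed

definition bit_labels :: "nat \<Rightarrow> (nat \<Rightarrow> bool) set" where
  "bit_labels r = {..<r} \<rightarrow>\<^sub>E UNIV"

definition kball ::
  "nat \<Rightarrow> nat \<Rightarrow> (letter list \<Rightarrow> 'v \<Rightarrow> 'v) \<Rightarrow> ('v \<Rightarrow> nat \<Rightarrow> bool) \<Rightarrow> 'v \<Rightarrow> 'v labeled_graph" where
  "kball r k \<phi> lab y =
    \<lparr>verts = {\<phi> w y | w. w \<in> carrier (free_group_fin r) \<and> length w \<le> k},
     root = y,
     vlabel = lab,
     elabel = (\<lambda>u v. {s. fst s < r \<and> \<phi> [s] u = v})\<rparr>"

text \<open>A ball only sees the orbit of its root, which is countable, so balls in actions on sets of
  natural numbers (finite or infinite) exhaust all isomorphism classes.\<close>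

definition ball_classes :: "nat \<Rightarrow> nat \<Rightarrow> nat labeled_graph set set" where
  "ball_classes r k =
    {iso_class (kball r k \<phi> lab y) | (Y :: nat set) \<phi> lab y.
      group_action (free_group_fin r) Y \<phi> \<and> lab \<in> Y \<rightarrow> bit_labels r \<and> y \<in> Y}"


section \<open>Sofic actions and relations\<close>

text \<open>The fair-coin measure on the Cantor space; its \<open>\<sigma>\<close>-algebra is the Borel \<open>\<sigma>\<close>-algebra of the
  product topology.\<close>

definition cantor_measure :: "(nat \<Rightarrow> bool) measure" where
  "cantor_measure = PiM UNIV (\<lambda>_. measure_pmf (bernoulli_pmf (1 / 2)))"

definition pmp_action :: "(letter list \<Rightarrow> (nat \<Rightarrow> bool) \<Rightarrow> (nat \<Rightarrow> bool)) \<Rightarrow> bool" where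
  "pmp_action \<Phi> \<longleftrightarrow> group_action free_group_inf UNIV \<Phi> \<and>
    (\<forall>w\<in>carrier free_group_inf.
      \<Phi> w \<in> measurable cantor_measure cantor_measure \<and>
      distr cantor_measure cantor_measure (\<Phi> w) = cantor_measure)"

definition sofic_action :: "(letter list \<Rightarrow> (nat \<Rightarrow> bool) \<Rightarrow> (nat \<Rightarrow> bool)) \<Rightarrow> bool" where
  "sofic_action \<Phi> \<longleftrightarrow> pmp_action \<Phi> \<and>
    (\<forall>r\<ge>1. \<exists>(Y :: nat \<Rightarrow> nat set) \<alpha> lab.
      (\<forall>n. finite (Y n) \<and> Y n \<noteq> {} \<and> group_action (free_group_fin r) (Y n) (\<alpha> n) \<and>
           lab n \<in> Y n \<rightarrow> bit_labels r) \<and>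
      (\<forall>k\<ge>1. \<forall>\<kappa>\<in>ball_classes r k.
        (\<lambda>n. real (card {y \<in> Y n. iso_class (kball r k (\<alpha> n) (lab n) y) = \<kappa>}) / real (card (Y n)))
        \<longlonglongrightarrow> measure cantor_measure
             {x. iso_class (kball r k \<Phi> (\<lambda>z. restrict z {..<r}) x) = \<kappa>}))"

definition orbit_relation ::
  "(letter list \<Rightarrow> (nat \<Rightarrow> bool) \<Rightarrow> (nat \<Rightarrow> bool)) \<Rightarrow> ((nat \<Rightarrow> bool) \<times> (nat \<Rightarrow> bool)) set" where
  "orbit_relation \<Phi> = {(x, y). \<exists>w\<in>carrier free_group_inf. \<Phi> w x = y}"

text \<open>The orbit relation of a measure-preserving Borel action of a countable group is a countable
  measured equivalence relation, so this need not be demanded separately.\<close>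

definition sofic_relation :: "((nat \<Rightarrow> bool) \<times> (nat \<Rightarrow> bool)) set \<Rightarrow> bool" where
  "sofic_relation E \<longleftrightarrow> (\<exists>\<Phi>. sofic_action \<Phi> \<and> E = orbit_relation \<Phi>)"


section \<open>The measurable full group\<close>

text \<open>For a bijection of a standard Borel space, measurability of the inverse follows from that of
  the map itself; it is listed so that \<open>borel_full_group E\<close> is evidently closed under inverses.\<close>

definition borel_full_group ::
  "((nat \<Rightarrow> bool) \<times> (nat \<Rightarrow> bool)) set \<Rightarrow> ((nat \<Rightarrow> bool) \<Rightarrow> (nat \<Rightarrow> bool)) monoid" where
  "borel_full_group E =
    \<lparr>carrier = {T. bij T \<and> T \<in> measurable cantor_measure cantor_measure \<and>
                   inv_into UNIV T \<in> measurable cantor_measure cantor_measure \<and>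
                   (\<forall>x. (T x, x) \<in> E)},
     monoid.mult = (\<circ>),
     one = id\<rparr>"

definition ae_trivial ::
  "((nat \<Rightarrow> bool) \<times> (nat \<Rightarrow> bool)) set \<Rightarrow> ((nat \<Rightarrow> bool) \<Rightarrow> (nat \<Rightarrow> bool)) set" where
  "ae_trivial E = {T \<in> carrier (borel_full_group E). AE x in cantor_measure. T x = x}"

definition full_group ::
  "((nat \<Rightarrow> bool) \<times> (nat \<Rightarrow> bool)) set \<Rightarrow> ((nat \<Rightarrow> bool) \<Rightarrow> (nat \<Rightarrow> bool)) set monoid" where
  "full_group E = borel_full_group E Mod ae_trivial E"

end

theory Submission imports Defs begin

text \<open>
  An element \<open>T\<close> of the full group moves each point by some word of the free group, and the word is a
  Borel function of the point. Up to a set of small measure it takes finitely many values and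
  depends on finitely many coordinates only, so that \<open>T x = \<Phi> (code (x restricted to r bits)) x\<close>. The
  same formula defines a self-map of every labeled finite action. Whether two such formulas compose
  to a third one, or whether one of them moves a point, is visible in a ball about the point. Since
  \<open>\<Phi>\<close> is sofic, finitely many such identities hold with about the same frequency in a suitable
  finite action. This separates \<open>T\<close> from the identity only by about the measure of its support,
  which depends on \<open>T\<close>; tensor powers push the distance to \<open>1\<close> at a bounded cost in multiplicativity.
\<close>

section \<open>Amplification by tensor powers\<close>

text \<open>No finite model can be expected to move almost all points: a nontrivial element of the
  full group may fix a set of positive measure, and its model fixes about the same proportion. All
  that is available for a finite set \<open>F\<close> is a lower bound \<open>c\<close> for the
  measures of the supports, which depends on \<open>F\<close> but not on the required accuracy.

  The action need not be free, so the word by which an element moves a point is not determined by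
  the point, and no identity between codes can be expected. Products are therefore compared as
  points: the word of \<open>U\<close> and the composed words of \<open>S\<close> and
  \<open>T\<close> must lead from the root to the same vertex. The code of \<open>S\<close> has to
  be read where \<open>T\<close> leads, and this is what the vertex labels are for: an isomorphism
  of balls preserves the labels along the way as well as the coincidences between words.

  A code approximates a bijection but may itself fail to be injective, in \<open>X\<close> as well
  as in the finite action. This is harmless because soficity is stated with arbitrary self-maps of a
  finite set, so no model has to be corrected to a permutation.\<close>

lemma card_neq_eq:
  assumes "finite A"
  shows "card {x\<in>A. \<alpha> x \<noteq> \<beta> x} + card {x\<in>A. \<alpha> x = \<beta> x} = card A"
proof -
  have "card ({x\<in>A. \<alpha> x \<noteq> \<beta> x} \<union> {x\<in>A. \<alpha> x = \<beta> x}) =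
      card {x\<in>A. \<alpha> x \<noteq> \<beta> x} + card {x\<in>A. \<alpha> x = \<beta> x}"
    using assms by (intro card_Un_disjoint) auto
  moreover have "{x\<in>A. \<alpha> x \<noteq> \<beta> x} \<union> {x\<in>A. \<alpha> x = \<beta> x} = A" by auto
  ultimately show ?thesis by simp
qed

text \<open>Agreements multiply under tensor powers, and they are also what ball frequencies count
  in the composition estimate.\<close>

lemma hamming_dist_agree:
  assumes "finite A" "A \<noteq> {}"
  shows "hamming_dist A \<alpha> \<beta> = 1 - real (card {x\<in>A. \<alpha> x = \<beta> x}) / real (card A)"
proof -
  have "real (card {x\<in>A. \<alpha> x \<noteq> \<beta> x}) + real (card {x\<in>A. \<alpha> x = \<beta> x}) = real (card A)"
    using card_neq_eq[OF assms(1), of \<alpha> \<beta>] by (metis of_nat_add)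
  moreover have "real (card A) \<noteq> 0" using assms by simp
  ultimately show ?thesis unfolding hamming_dist_def by (simp add: field_simps)
qed

lemma hamming_dist_le_1:
  assumes "finite A" shows "hamming_dist A \<alpha> \<beta> \<le> 1"
  unfolding hamming_dist_def
  using card_mono[OF assms, of "{x\<in>A. \<alpha> x \<noteq> \<beta> x}"] by (auto simp: divide_le_eq_1)

lemma hamming_dist_cong:
  assumes "\<And>x. x \<in> A \<Longrightarrow> \<alpha> x = \<alpha>' x" "\<And>x. x \<in> A \<Longrightarrow> \<beta> x = \<beta>' x"
  shows "hamming_dist A \<alpha> \<beta> = hamming_dist A \<alpha>' \<beta>'"
proof -
  have "{x\<in>A. \<alpha> x \<noteq> \<beta> x} = {x\<in>A. \<alpha>' x \<noteq> \<beta>' x}" using assms by auto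
  then show ?thesis by (simp add: hamming_dist_def)
qed

text \<open>The coding \<open>e\<close> is needed because \<^const>\<open>sofic_group\<close> asks for sets of natural numbers.\<close>

definition tensor_map ::
  "nat \<Rightarrow> ((nat \<Rightarrow> 'a) \<Rightarrow> nat) \<Rightarrow> 'a set \<Rightarrow> ('a \<Rightarrow> 'a) \<Rightarrow> nat \<Rightarrow> nat" where
  "tensor_map m e A \<alpha> = (\<lambda>n\<in>e ` ({..<m} \<rightarrow>\<^sub>E A).
     e (\<lambda>i\<in>{..<m}. \<alpha> (inv_into ({..<m} \<rightarrow>\<^sub>E A) e n i)))"

context
  fixes m :: nat and e :: "(nat \<Rightarrow> 'a) \<Rightarrow> nat" and A :: "'a set"
  assumes e: "inj_on e ({..<m} \<rightarrow>\<^sub>E A)"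
begin

lemma tensor_map_apply:
  "b \<in> {..<m} \<rightarrow>\<^sub>E A \<Longrightarrow> tensor_map m e A \<alpha> (e b) = e (\<lambda>i\<in>{..<m}. \<alpha> (b i))"
  unfolding tensor_map_def using e by simp

lemma tensor_map_closed:
  assumes "\<alpha> \<in> A \<rightarrow> A"
  shows "tensor_map m e A \<alpha> \<in> e ` ({..<m} \<rightarrow>\<^sub>E A) \<rightarrow>\<^sub>E e ` ({..<m} \<rightarrow>\<^sub>E A)"
proof -
  have "tensor_map m e A \<alpha> (e b) \<in> e ` ({..<m} \<rightarrow>\<^sub>E A)" if "b \<in> {..<m} \<rightarrow>\<^sub>E A" for b
    unfolding tensor_map_apply[OF that] using that assms by (intro imageI) auto
  then show ?thesis by (auto simp: tensor_map_def PiE_iff)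
qed

lemma tensor_map_id: "tensor_map m e A (\<lambda>x\<in>A. x) = (\<lambda>n\<in>e ` ({..<m} \<rightarrow>\<^sub>E A). n)"
proof
  fix n
  show "tensor_map m e A (\<lambda>x\<in>A. x) n = (\<lambda>n\<in>e ` ({..<m} \<rightarrow>\<^sub>E A). n) n"
  proof (cases "n \<in> e ` ({..<m} \<rightarrow>\<^sub>E A)")
    case True
    then obtain b where b: "n = e b" "b \<in> {..<m} \<rightarrow>\<^sub>E A" by blast
    then have "(\<lambda>i\<in>{..<m}. (\<lambda>x\<in>A. x) (b i)) = b"
      by (auto simp: fun_eq_iff PiE_iff extensional_def)
    with b show ?thesis by (simp only: tensor_map_apply[OF b(2)]) simp
  qed (simp add: tensor_map_def)
qed

lemma tensor_map_compose:
  assumes "\<alpha> \<in> A \<rightarrow> A" "\<beta> \<in> A \<rightarrow> A"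
  shows "tensor_map m e A (compose A \<alpha> \<beta>) =
    compose (e ` ({..<m} \<rightarrow>\<^sub>E A)) (tensor_map m e A \<alpha>) (tensor_map m e A \<beta>)"
proof
  fix n
  show "tensor_map m e A (compose A \<alpha> \<beta>) n =
    compose (e ` ({..<m} \<rightarrow>\<^sub>E A)) (tensor_map m e A \<alpha>) (tensor_map m e A \<beta>) n"
  proof (cases "n \<in> e ` ({..<m} \<rightarrow>\<^sub>E A)")
    case True
    then obtain b where b: "n = e b" "b \<in> {..<m} \<rightarrow>\<^sub>E A" by blast
    have b': "(\<lambda>i\<in>{..<m}. \<beta> (b i)) \<in> {..<m} \<rightarrow>\<^sub>E A" using b assms by auto
    have "(\<lambda>i\<in>{..<m}. compose A \<alpha> \<beta> (b i)) = (\<lambda>i\<in>{..<m}. \<alpha> ((\<lambda>i\<in>{..<m}. \<beta> (b i)) i))"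
      using b by (auto simp: fun_eq_iff PiE_iff compose_def)
    then show ?thesis using True b
      by (simp add: compose_def[of "e ` _"] tensor_map_apply[OF b(2)] tensor_map_apply[OF b'])
  qed (simp add: tensor_map_def compose_def)
qed

text \<open>Two tensor powers agree at a tuple iff the maps agree at each coordinate, so the
  agreement set is the \<open>m\<close>-th power of the original one, and so is its
  proportion.\<close>

lemma hamming_dist_tensor_map:
  assumes A: "finite A" "A \<noteq> {}" and "\<alpha> \<in> A \<rightarrow> A" "\<beta> \<in> A \<rightarrow> A"
  shows "hamming_dist (e ` ({..<m} \<rightarrow>\<^sub>E A)) (tensor_map m e A \<alpha>) (tensor_map m e A \<beta>) =
    1 - (1 - hamming_dist A \<alpha> \<beta>) ^ m"
proof -
  let ?B = "{..<m} \<rightarrow>\<^sub>E A" and ?G = "{x\<in>A. \<alpha> x = \<beta> x}"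
  have "{n \<in> e ` ?B. tensor_map m e A \<alpha> n = tensor_map m e A \<beta> n} = e ` ({..<m} \<rightarrow>\<^sub>E ?G)"
  proof -
    have "tensor_map m e A \<alpha> (e b) = tensor_map m e A \<beta> (e b) \<longleftrightarrow> b \<in> {..<m} \<rightarrow>\<^sub>E ?G"
      if b: "b \<in> ?B" for b
    proof -
      have "(\<lambda>i\<in>{..<m}. \<alpha> (b i)) \<in> ?B" "(\<lambda>i\<in>{..<m}. \<beta> (b i)) \<in> ?B" using b assms by auto
      then have "tensor_map m e A \<alpha> (e b) = tensor_map m e A \<beta> (e b) \<longleftrightarrow>
          (\<lambda>i\<in>{..<m}. \<alpha> (b i)) = (\<lambda>i\<in>{..<m}. \<beta> (b i))"
        unfolding tensor_map_apply[OF b] using e by (simp add: inj_on_eq_iff)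
      also have "\<dots> \<longleftrightarrow> (\<forall>i<m. \<alpha> (b i) = \<beta> (b i))"
        by (auto simp: fun_eq_iff restrict_def)
      also have "\<dots> \<longleftrightarrow> b \<in> {..<m} \<rightarrow>\<^sub>E ?G" using b by (auto simp: PiE_iff)
      finally show ?thesis .
    qed
    moreover have "({..<m} \<rightarrow>\<^sub>E ?G) \<subseteq> ?B" by (rule PiE_mono) auto
    ultimately show ?thesis by blast
  qed
  moreover have "card (e ` ({..<m} \<rightarrow>\<^sub>E ?G)) = card ?G ^ m"
    by (subst card_image[OF inj_on_subset[OF e]]) (auto simp: card_PiE PiE_iff)
  moreover have "card (e ` ?B) = card A ^ m"
    by (subst card_image[OF e]) (auto simp: card_PiE)
  moreover have "finite (e ` ?B)" "e ` ?B \<noteq> {}"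
    using A by (auto intro!: finite_PiE simp: PiE_eq_empty_iff)
  ultimately show ?thesis
    by (simp add: hamming_dist_agree A power_divide)
qed

end

text \<open>The order of quantifiers is essential: \<open>c\<close> comes before the accuracy, so
  the exponent \<open>m\<close> can be chosen from \<open>c\<close> and the target \<epsilon>, and a
  model accurate enough to survive the \<open>m\<close>-th power is requested only
  afterwards.\<close>

lemma sofic_group_amplify:
  assumes "group G"
    and approx: "\<And>F. finite F \<Longrightarrow> F \<subseteq> carrier G \<Longrightarrow>
      \<exists>c>0. \<forall>\<epsilon>>0. \<exists>(A :: nat set) \<Theta>. finite A \<and> A \<noteq> {} \<and> \<Theta> \<in> carrier G \<rightarrow> (A \<rightarrow>\<^sub>E A) \<and>
        (\<forall>f\<in>F. \<forall>g\<in>F. f \<otimes>\<^bsub>G\<^esub> g \<in> F \<longrightarrow>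
            hamming_dist A (\<Theta> (f \<otimes>\<^bsub>G\<^esub> g)) (compose A (\<Theta> f) (\<Theta> g)) \<le> \<epsilon>) \<and>
        (\<forall>f\<in>F. f \<noteq> \<one>\<^bsub>G\<^esub> \<longrightarrow> hamming_dist A (\<Theta> f) (\<lambda>x\<in>A. x) > c) \<and>
        \<Theta> \<one>\<^bsub>G\<^esub> = (\<lambda>x\<in>A. x)"
  shows "sofic_group G"
  unfolding sofic_group_def
proof (intro conjI allI impI)
  fix F and \<epsilon> :: real
  assume F: "finite F" "F \<subseteq> carrier G" and "0 < \<epsilon>"
  obtain c where "c > 0" and c: "\<And>\<epsilon>. \<epsilon> > 0 \<Longrightarrow>
      \<exists>(A :: nat set) \<Theta>. finite A \<and> A \<noteq> {} \<and> \<Theta> \<in> carrier G \<rightarrow> (A \<rightarrow>\<^sub>E A) \<and>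
        (\<forall>f\<in>F. \<forall>g\<in>F. f \<otimes>\<^bsub>G\<^esub> g \<in> F \<longrightarrow>
            hamming_dist A (\<Theta> (f \<otimes>\<^bsub>G\<^esub> g)) (compose A (\<Theta> f) (\<Theta> g)) \<le> \<epsilon>) \<and>
        (\<forall>f\<in>F. f \<noteq> \<one>\<^bsub>G\<^esub> \<longrightarrow> hamming_dist A (\<Theta> f) (\<lambda>x\<in>A. x) > c) \<and>
        \<Theta> \<one>\<^bsub>G\<^esub> = (\<lambda>x\<in>A. x)"
    using approx[OF F] by blast
  \<comment> \<open>Capping at \<open>1\<close> keeps \<open>1 - d\<close> in \<open>[0, 1)\<close>,
    so that its powers tend to zero and are monotone in the base.\<close>
  define d where "d = min c 1"
  have d: "0 < d" "d \<le> 1" "d \<le> c" using \<open>c > 0\<close> by (auto simp: d_def)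
  obtain m where m: "(1 - d) ^ m < \<epsilon>"
    using real_arch_pow_inv[OF \<open>0 < \<epsilon>\<close>, of "1 - d"] d by auto
  \<comment> \<open>By Bernoulli's inequality the \<open>m\<close>-th power enlarges an error at
    most by the factor \<open>m\<close>; the extra \<open>1\<close> covers
    \<open>m = 0\<close>.\<close>
  define \<delta> where "\<delta> = \<epsilon> / (real m + 1)"
  have "\<delta> > 0" using \<open>0 < \<epsilon>\<close> by (simp add: \<delta>_def)
  obtain A :: "nat set" and \<Theta> where A: "finite A" "A \<noteq> {}" and \<Theta>: "\<Theta> \<in> carrier G \<rightarrow> (A \<rightarrow>\<^sub>E A)"
    and mult: "\<And>f g. f \<in> F \<Longrightarrow> g \<in> F \<Longrightarrow> f \<otimes>\<^bsub>G\<^esub> g \<in> F \<Longrightarrow>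
            hamming_dist A (\<Theta> (f \<otimes>\<^bsub>G\<^esub> g)) (compose A (\<Theta> f) (\<Theta> g)) \<le> \<delta>"
    and sep: "\<And>f. f \<in> F \<Longrightarrow> f \<noteq> \<one>\<^bsub>G\<^esub> \<Longrightarrow> hamming_dist A (\<Theta> f) (\<lambda>x\<in>A. x) > c"
    and one: "\<Theta> \<one>\<^bsub>G\<^esub> = (\<lambda>x\<in>A. x)"
    using c[OF \<open>\<delta> > 0\<close>] by blast
  let ?B = "{..<m} \<rightarrow>\<^sub>E A"
  have B: "finite ?B" using A by (intro finite_PiE) auto
  obtain e :: "(nat \<Rightarrow> nat) \<Rightarrow> nat" where e: "inj_on e ?B"
    using finite_imp_inj_to_nat_seg[OF B] by blast
  let ?T = "tensor_map m e A"
  have \<Theta>A: "\<Theta> f \<in> A \<rightarrow> A" if "f \<in> carrier G" for f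
    using \<Theta> that by (auto simp: PiE_def)
  have idA: "(\<lambda>x\<in>A. x) \<in> A \<rightarrow> A" by auto
  show "\<exists>(A :: nat set) \<Theta>. finite A \<and> A \<noteq> {} \<and> \<Theta> \<in> carrier G \<rightarrow> (A \<rightarrow>\<^sub>E A) \<and>
        (\<forall>f\<in>F. \<forall>g\<in>F. f \<otimes>\<^bsub>G\<^esub> g \<in> F \<longrightarrow>
            hamming_dist A (\<Theta> (f \<otimes>\<^bsub>G\<^esub> g)) (compose A (\<Theta> f) (\<Theta> g)) \<le> \<epsilon>) \<and>
        (\<forall>f\<in>F. f \<noteq> \<one>\<^bsub>G\<^esub> \<longrightarrow> hamming_dist A (\<Theta> f) (\<lambda>x\<in>A. x) > 1 - \<epsilon>) \<and>
        \<Theta> \<one>\<^bsub>G\<^esub> = (\<lambda>x\<in>A. x)"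
  proof (intro exI[of _ "e ` ?B"] exI[of _ "\<lambda>f. ?T (\<Theta> f)"] conjI ballI impI)
    show "finite (e ` ?B)" using B by simp
    show "e ` ?B \<noteq> {}" using A by (auto simp: PiE_eq_empty_iff)
    show "(\<lambda>f. ?T (\<Theta> f)) \<in> carrier G \<rightarrow> (e ` ?B \<rightarrow>\<^sub>E e ` ?B)"
      by (intro funcsetI tensor_map_closed[OF e] \<Theta>A)
    show "?T (\<Theta> \<one>\<^bsub>G\<^esub>) = (\<lambda>x\<in>e ` ?B. x)"
      unfolding one by (rule tensor_map_id[OF e])
  next
    fix f g assume fg: "f \<in> F" "g \<in> F" "f \<otimes>\<^bsub>G\<^esub> g \<in> F"
    let ?h = "hamming_dist A (\<Theta> (f \<otimes>\<^bsub>G\<^esub> g)) (compose A (\<Theta> f) (\<Theta> g))"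
    have car: "f \<in> carrier G" "g \<in> carrier G" "f \<otimes>\<^bsub>G\<^esub> g \<in> carrier G" using fg F by auto
    have cl: "compose A (\<Theta> f) (\<Theta> g) \<in> A \<rightarrow> A"
      using \<Theta>A[OF car(1)] \<Theta>A[OF car(2)] by (auto simp: compose_def)
    have "1 + real m * (- ?h) \<le> (1 + (- ?h)) ^ m"
      by (rule Bernoulli_inequality) (use hamming_dist_le_1[OF A(1)] in auto)
    then have "1 - (1 - ?h) ^ m \<le> real m * ?h" by simp
    also have "\<dots> \<le> real m * \<delta>" using mult[OF fg] by (intro mult_left_mono) auto
    also have "\<dots> \<le> \<epsilon>" using \<open>0 < \<epsilon>\<close> by (simp add: \<delta>_def field_simps)
    finally show "hamming_dist (e ` ?B) (?T (\<Theta> (f \<otimes>\<^bsub>G\<^esub> g)))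
        (compose (e ` ?B) (?T (\<Theta> f)) (?T (\<Theta> g))) \<le> \<epsilon>"
      by (simp only: hamming_dist_tensor_map[OF e A \<Theta>A[OF car(3)] cl]
        tensor_map_compose[OF e \<Theta>A[OF car(1)] \<Theta>A[OF car(2)], symmetric])
  next
    fix f assume f: "f \<in> F" "f \<noteq> \<one>\<^bsub>G\<^esub>"
    have "f \<in> carrier G" using f F by auto
    have "(1 - hamming_dist A (\<Theta> f) (\<lambda>x\<in>A. x)) ^ m \<le> (1 - d) ^ m"
      using sep[OF f] d hamming_dist_le_1[OF A(1)] by (intro power_mono) auto
    with m show "hamming_dist (e ` ?B) (?T (\<Theta> f)) (\<lambda>x\<in>e ` ?B. x) > 1 - \<epsilon>"
      using hamming_dist_tensor_map[OF e A \<Theta>A[OF \<open>f \<in> carrier G\<close>] idA]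
      by (simp add: tensor_map_id[OF e])
  qed
qed (fact assms(1))

section \<open>Actions of free groups\<close>

lemma carrier_free_group: "w \<in> carrier (free_group I) \<longleftrightarrow> reduced w \<and> fst ` set w \<subseteq> I"
  by (simp add: free_group_def)

lemma mult_free_group: "u \<otimes>\<^bsub>free_group I\<^esub> v = foldr push u v"
  by (simp add: free_group_def)

lemma one_free_group: "\<one>\<^bsub>free_group I\<^esub> = []"
  by (simp add: free_group_def)

lemma free_group_carrier_mono: "I \<subseteq> J \<Longrightarrow> carrier (free_group I) \<subseteq> carrier (free_group J)"
  by (auto simp: free_group_def)

lemma Nil_in_free_group: "[] \<in> carrier (free_group I)"
  by (simp add: carrier_free_group)

lemma Cons_in_free_group:
  assumes "s # w \<in> carrier (free_group I)"
  shows "[s] \<in> carrier (free_group I)" "w \<in> carrier (free_group I)" "fst s \<in> I"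
    "s # w = [s] \<otimes>\<^bsub>free_group I\<^esub> w"
proof -
  show "[s] \<in> carrier (free_group I)" "w \<in> carrier (free_group I)" "fst s \<in> I"
    using assms by (auto simp: carrier_free_group reduced_Cons)
  show "s # w = [s] \<otimes>\<^bsub>free_group I\<^esub> w"
    using assms by (cases w) (auto simp: carrier_free_group mult_free_group reduced_Cons)
qed

lemma length_foldr_push: "length (foldr push u v) \<le> length u + length v"
proof (induction u)
  case (Cons s u)
  have "length (push s w) \<le> Suc (length w)" for w by (cases w) auto
  with Cons show ?case by (auto intro: order_trans)
qed auto

text \<open>Multiplication is the same function of words for every set of generators, so the
  homomorphism simply restricts. This gives the action of the first \<open>r\<close>
  generators.\<close>

lemma group_action_free_group_mono:
  assumes "group_action (free_group J) Y \<phi>" "I \<subseteq> J"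
  shows "group_action (free_group I) Y \<phi>"
proof -
  interpret J: group_action "free_group J" Y \<phi> by fact
  interpret gh: group_hom "free_group J" "BijGroup Y" \<phi> by (rule J.group_hom)
  have "\<phi> \<in> hom (free_group I) (BijGroup Y)"
  proof (rule homI)
    fix x assume "x \<in> carrier (free_group I)"
    then show "\<phi> x \<in> carrier (BijGroup Y)"
      using free_group_carrier_mono[OF assms(2)] by auto
  next
    fix x y assume "x \<in> carrier (free_group I)" "y \<in> carrier (free_group I)"
    then have "x \<in> carrier (free_group J)" "y \<in> carrier (free_group J)"
      using free_group_carrier_mono[OF assms(2)] by auto
    from gh.hom_mult[OF this] show "\<phi> (x \<otimes>\<^bsub>free_group I\<^esub> y) = \<phi> x \<otimes>\<^bsub>BijGroup Y\<^esub> \<phi> y"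
      by (simp add: mult_free_group)
  qed
  then show ?thesis
    unfolding group_action_def group_hom_def group_hom_axioms_def
    using group_free_group group_BijGroup by blast
qed

section \<open>Balls\<close>

text \<open>Words serve as names for the vertices of a ball; one vertex may have several
  names.\<close>

definition short_words :: "nat \<Rightarrow> nat \<Rightarrow> letter list set" where
  "short_words r k = {w \<in> carrier (free_group_fin r). length w \<le> k}"

lemma finite_letters: "finite {s :: letter. fst s < r}"
proof -
  have "{s :: letter. fst s < r} = {..<r} \<times> UNIV" by auto
  then show ?thesis by simp
qed

lemma finite_short_words: "finite (short_words r k)"
proof (rule finite_subset)
  show "short_words r k \<subseteq> {w. set w \<subseteq> {s. fst s < r} \<and> length w \<le> k}"
    by (auto simp: short_words_def carrier_free_group)
  show "finite {w. set w \<subseteq> {s :: letter. fst s < r} \<and> length w \<le> k}"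
    using finite_lists_length_le[OF finite_letters] .
qed

lemma short_words_mono: "r \<le> r' \<Longrightarrow> k \<le> k' \<Longrightarrow> short_words r k \<subseteq> short_words r' k'"
  by (auto simp: short_words_def carrier_free_group)

lemma short_words_carrier: "w \<in> short_words r k \<Longrightarrow> w \<in> carrier free_group_inf"
  by (auto simp: short_words_def carrier_free_group)

lemma finite_subset_short_words:
  assumes "finite W" "W \<subseteq> carrier free_group_inf"
  shows "\<exists>r k. W \<subseteq> short_words r k"
  using assms
proof (induction W)
  case (insert w W)
  then obtain r k where W: "W \<subseteq> short_words r k" by auto
  obtain m where m: "\<forall>i\<in>fst ` set w. i < m"
    using finite_nat_set_iff_bounded[of "fst ` set w"] by auto
  then have "w \<in> short_words m (length w)"
    using insert.prems by (auto simp: short_words_def carrier_free_group)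
  then have "insert w W \<subseteq> short_words (max r m) (max k (length w))"
    using W short_words_mono[of r "max r m" k "max k (length w)"]
      short_words_mono[of m "max r m" "length w" "max k (length w)"] by auto
  then show ?case by blast
qed auto

lemma kball_sel [simp]:
  "verts (kball r k \<phi> lab y) = (\<lambda>w. \<phi> w y) ` short_words r k"
  "root (kball r k \<phi> lab y) = y"
  "vlabel (kball r k \<phi> lab y) = lab"
  "elabel (kball r k \<phi> lab y) u v = {s. fst s < r \<and> \<phi> [s] u = v}"
  by (auto simp: kball_def short_words_def)

lemma Nil_in_short_words [simp]: "[] \<in> short_words r k"
  by (simp add: short_words_def Nil_in_free_group)

lemma group_action_Nil:
  assumes "group_action (free_group I) Y \<phi>" "y \<in> Y"
  shows "\<phi> [] y = y"
  using group_action.id_eq_one[OF assms(1)] assms(2) by (metis one_free_group restrict_apply')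

lemma group_action_push:
  assumes "group_action (free_group I) Y \<phi>" "y \<in> Y"
    "u \<in> carrier (free_group I)" "v \<in> carrier (free_group I)"
  shows "\<phi> (foldr push u v) y = \<phi> u (\<phi> v y)"
  using group_action.composition_rule[OF assms] by (simp add: mult_free_group)

lemma root_in_kball:
  assumes "group_action (free_group_fin r) Y \<phi>" "y \<in> Y"
  shows "root (kball r k \<phi> lab y) \<in> verts (kball r k \<phi> lab y)"
  using group_action_Nil[OF assms] by (auto intro!: image_eqI[of _ _ "[]"])

lemma finite_kball: "finite (verts (kball r k \<phi> lab y))"
  by (simp add: finite_short_words)

text \<open>The unique candidate for an isomorphism of balls is \<open>\<phi> w x \<mapsto> \<psi> w y\<close>, since the edge labels
  determine the image of every path issuing from the root.\<close>

lemma labeled_iso_kballD: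
  assumes act: "group_action (free_group_fin r) X \<phi>" "x \<in> X"
      "group_action (free_group_fin r) Y \<psi>" "y \<in> Y"
    and iso: "labeled_iso (kball r k \<phi> lab x) (kball r k \<psi> lab' y)"
  shows "u \<in> short_words r k \<Longrightarrow> v \<in> short_words r k \<Longrightarrow> \<phi> u x = \<phi> v x \<longleftrightarrow> \<psi> u y = \<psi> v y"
    and "u \<in> short_words r k \<Longrightarrow> lab (\<phi> u x) = lab' (\<psi> u y)"
proof -
  let ?G = "kball r k \<phi> lab x" and ?H = "kball r k \<psi> lab' y"
  obtain f where f: "bij_betw f (verts ?G) (verts ?H)" "f x = y"
      "\<And>u. u\<in>verts ?G \<Longrightarrow> lab' (f u) = lab u"
      "\<And>u v. u\<in>verts ?G \<Longrightarrow> v\<in>verts ?G \<Longrightarrow> elabel ?H (f u) (f v) = elabel ?G u v"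
    using iso unfolding labeled_iso_def kball_sel(2,3) by blast
  have path: "f (\<phi> w x) = \<psi> w y" if "w \<in> short_words r k" for w
    using that
  proof (induction w)
    case Nil
    show ?case using act f(2) by (simp add: group_action_Nil)
  next
    case (Cons s w)
    then have sw: "s # w \<in> carrier (free_group_fin r)" by (simp add: short_words_def)
    note c = Cons_in_free_group[OF sw]
    have w: "w \<in> short_words r k" using Cons.prems c(2) by (simp add: short_words_def)
    have eq: "\<phi> (s # w) x = \<phi> [s] (\<phi> w x)" "\<psi> (s # w) y = \<psi> [s] (\<psi> w y)"
      using group_action.composition_rule[OF act(1,2) c(1,2)]
        group_action.composition_rule[OF act(3,4) c(1,2)] by (simp_all flip: c(4))
    \<comment> \<open>The letter \<open>s\<close> lies in the label of exactly one edge leaving a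
      vertex, so preserving edge labels forces the image of the next vertex.\<close>
    have "s \<in> elabel ?G (\<phi> w x) (\<phi> (s # w) x)" using c(3) eq by simp
    also have "\<dots> = elabel ?H (f (\<phi> w x)) (f (\<phi> (s # w) x))"
      using w Cons.prems by (intro f(4)[symmetric]) auto
    finally show ?case using Cons.IH[OF w] eq by simp
  qed
  show "\<phi> u x = \<phi> v x \<longleftrightarrow> \<psi> u y = \<psi> v y" if uv: "u \<in> short_words r k" "v \<in> short_words r k"
  proof -
    have "f (\<phi> u x) = f (\<phi> v x) \<longleftrightarrow> \<phi> u x = \<phi> v x"
      using uv f(1) by (intro inj_on_eq_iff[of f "verts ?G"]) (auto simp: bij_betw_def)
    then show ?thesis by (simp add: path uv)
  qed
  show "lab (\<phi> u x) = lab' (\<psi> u y)" if "u \<in> short_words r k"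
    using f(3)[of "\<phi> u x"] path[OF that] that by auto
qed

text \<open>Edges need an assumption of their own: from a vertex at distance \<open>k\<close>, a
  letter may lead back into the ball although the prolonged word is too long for
  \<open>eq\<close>.\<close>

lemma labeled_iso_kballI:
  assumes act: "group_action (free_group_fin r) X \<phi>" "x \<in> X"
      "group_action (free_group_fin r) Y \<psi>" "y \<in> Y"
    and eq: "\<And>u v. u \<in> short_words r k \<Longrightarrow> v \<in> short_words r k \<Longrightarrow> \<phi> u x = \<phi> v x \<longleftrightarrow> \<psi> u y = \<psi> v y"
    and lab: "\<And>u. u \<in> short_words r k \<Longrightarrow> lab (\<phi> u x) = lab' (\<psi> u y)"
    and edge: "\<And>u v s. u \<in> short_words r k \<Longrightarrow> v \<in> short_words r k \<Longrightarrow> fst s < r \<Longrightarrow>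
      \<phi> [s] (\<phi> u x) = \<phi> v x \<longleftrightarrow> \<psi> [s] (\<psi> u y) = \<psi> v y"
  shows "labeled_iso (kball r k \<phi> lab x) (kball r k \<psi> lab' y)"
proof -
  \<comment> \<open>The choice of a word reaching \<open>p\<close> is immaterial, because by
    \<open>eq\<close> all such words reach the same point from \<open>y\<close>.\<close>
  define f where "f p = \<psi> (SOME w. w \<in> short_words r k \<and> \<phi> w x = p) y" for p
  have f: "f (\<phi> w x) = \<psi> w y" if "w \<in> short_words r k" for w
  proof -
    let ?w' = "SOME w'. w' \<in> short_words r k \<and> \<phi> w' x = \<phi> w x"
    have "?w' \<in> short_words r k \<and> \<phi> ?w' x = \<phi> w x"
      by (rule someI[of _ w]) (use that in auto)
    then show ?thesis using eq[of ?w' w] that by (simp add: f_def)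
  qed
  have "bij_betw f ((\<lambda>w. \<phi> w x) ` short_words r k) ((\<lambda>w. \<psi> w y) ` short_words r k)"
    unfolding bij_betw_def
  proof
    show "inj_on f ((\<lambda>w. \<phi> w x) ` short_words r k)"
      by (rule inj_onI) (auto simp: f eq)
    show "f ` (\<lambda>w. \<phi> w x) ` short_words r k = (\<lambda>w. \<psi> w y) ` short_words r k"
      by (simp add: image_image f)
  qed
  moreover have "f x = y"
    using f[of "[]"] act by (simp add: group_action_Nil)
  ultimately show ?thesis
    unfolding labeled_iso_def kball_sel
    by (intro exI[of _ f]) (use lab edge in \<open>auto simp: f\<close>)
qed

text \<open>Here \<open>c\<close> factors through \<open>d\<close> on \<open>S\<close>. It serves to
  count isomorphism classes through an invariant whose values visibly lie in a finite set.\<close>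

lemma finite_image_of_invariant:
  assumes "finite (d ` S)" "\<And>a b. a \<in> S \<Longrightarrow> b \<in> S \<Longrightarrow> d a = d b \<Longrightarrow> c a = c b"
  shows "finite (c ` S)"
proof (rule finite_surj[OF assms(1)])
  have "c a = c (inv_into S d (d a))" if "a \<in> S" for a
    using that by (intro assms(2)) (auto simp: inv_into_into f_inv_into_f)
  then show "c ` S \<subseteq> (\<lambda>z. c (inv_into S d z)) ` d ` S" by blast
qed

text \<open>A ball is determined up to isomorphism by finitely many yes-no questions about short
  words. Finiteness is what allows limits of frequencies to be summed over all classes.\<close>

lemma finite_ball_classes: "finite (ball_classes r k)"
proof -
  let ?W = "short_words r k"
  define S where "S = {(Y :: nat set, \<phi>, lab, y).
    group_action (free_group_fin r) Y \<phi> \<and> lab \<in> Y \<rightarrow> bit_labels r \<and> y \<in> Y}"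
  define c where "c = (\<lambda>(Y :: nat set, \<phi>, lab, y :: nat). iso_class (kball r k \<phi> lab y))"
  \<comment> \<open>The invariant records which words coincide at the root, the first
    \<open>r\<close> bits at the vertex of each word, and which letters join the vertices of two
    words.\<close>
  define d where "d = (\<lambda>(Y :: nat set, \<phi> :: letter list \<Rightarrow> nat \<Rightarrow> nat, lab :: nat \<Rightarrow> nat \<Rightarrow> bool, y).
    ({(u, v) \<in> ?W \<times> ?W. \<phi> u y = \<phi> v y}, {(u, i) \<in> ?W \<times> {..<r}. lab (\<phi> u y) i},
     {(u, v, s) \<in> ?W \<times> ?W \<times> {s. fst s < r}. \<phi> [s] (\<phi> u y) = \<phi> v y}))"
  have "ball_classes r k = c ` S"
    unfolding ball_classes_def c_def S_def by (auto simp: image_iff; blast)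
  moreover have "finite (c ` S)"
  proof (rule finite_image_of_invariant)
    have "d ` S \<subseteq> Pow (?W \<times> ?W) \<times> Pow (?W \<times> {..<r}) \<times> Pow (?W \<times> ?W \<times> {s. fst s < r})"
      unfolding d_def by fastforce
    then show "finite (d ` S)"
      by (rule finite_subset) (auto simp: finite_short_words finite_letters)
    fix a b assume ab: "a \<in> S" "b \<in> S" "d a = d b"
    obtain Y \<phi> lab y where a: "a = (Y, \<phi>, lab, y)" by (metis prod_cases4)
    obtain Y' \<psi> lab' y' where b: "b = (Y', \<psi>, lab', y')" by (metis prod_cases4)
    have actY: "group_action (free_group_fin r) Y \<phi>" "y \<in> Y" and lab: "lab \<in> Y \<rightarrow> bit_labels r"
      using ab a by (auto simp: S_def)
    have actY': "group_action (free_group_fin r) Y' \<psi>" "y' \<in> Y'" and lab': "lab' \<in> Y' \<rightarrow> bit_labels r"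
      using ab b by (auto simp: S_def)
    have d1: "{(u, v) \<in> ?W \<times> ?W. \<phi> u y = \<phi> v y} = {(u, v) \<in> ?W \<times> ?W. \<psi> u y' = \<psi> v y'}"
      and d2: "{(u, i) \<in> ?W \<times> {..<r}. lab (\<phi> u y) i} = {(u, i) \<in> ?W \<times> {..<r}. lab' (\<psi> u y') i}"
      and d3: "{(u, v, s) \<in> ?W \<times> ?W \<times> {s. fst s < r}. \<phi> [s] (\<phi> u y) = \<phi> v y} =
        {(u, v, s) \<in> ?W \<times> ?W \<times> {s. fst s < r}. \<psi> [s] (\<psi> u y') = \<psi> v y'}"
      using ab(3) by (simp_all add: a b d_def)
    have "labeled_iso (kball r k \<phi> lab y) (kball r k \<psi> lab' y')"
    proof (rule labeled_iso_kballI[OF actY actY'])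
      fix u v assume "u \<in> ?W" "v \<in> ?W"
      then show "\<phi> u y = \<phi> v y \<longleftrightarrow> \<psi> u y' = \<psi> v y'"
        using d1[THEN eqset_imp_iff, of "(u, v)"] by simp
    next
      fix u assume u: "u \<in> ?W"
      then have "u \<in> carrier (free_group_fin r)" by (simp add: short_words_def)
      then have "\<phi> u y \<in> Y" "\<psi> u y' \<in> Y'"
        using actY actY' group_action.element_image by metis+
      \<comment> \<open>Elements of \<open>bit_labels r\<close> are extensional, so the
        \<open>r\<close> bits recorded in \<open>d\<close> determine the whole label.\<close>
      then have ext: "lab (\<phi> u y) \<in> {..<r} \<rightarrow>\<^sub>E UNIV" "lab' (\<psi> u y') \<in> {..<r} \<rightarrow>\<^sub>E UNIV"
        using lab lab' by (auto simp: bit_labels_def)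
      show "lab (\<phi> u y) = lab' (\<psi> u y')"
      proof (rule PiE_ext[OF ext])
        fix i assume "i \<in> {..<r}"
        with u show "lab (\<phi> u y) i = lab' (\<psi> u y') i"
          using d2[THEN eqset_imp_iff, of "(u, i)"] by simp
      qed
    next
      fix u v :: "letter list" and s :: letter assume "u \<in> ?W" "v \<in> ?W" "fst s < r"
      then show "\<phi> [s] (\<phi> u y) = \<phi> v y \<longleftrightarrow> \<psi> [s] (\<psi> u y') = \<psi> v y'"
        using d3[THEN eqset_imp_iff, of "(u, v, s)"] by simp
    qed
    then show "c a = c b"
      unfolding a b c_def
      by (simp add: iso_class_eq_iff[OF finite_kball root_in_kball[OF actY] root_in_kball[OF actY']])
  qed
  ultimately show ?thesis by simp
qed

section \<open>Ball statistics\<close>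

lemma space_cantor [simp]: "space cantor_measure = UNIV"
  by (auto simp: cantor_measure_def space_PiM)

interpretation cantor: prob_space cantor_measure
  unfolding cantor_measure_def by (intro prob_space_PiM measure_pmf.prob_space_axioms)

lemma sum_card_fibers:
  assumes "finite Y" "finite K"
  shows "(\<Sum>\<kappa>\<in>K. card {y\<in>Y. c y = \<kappa>}) = card {y\<in>Y. c y \<in> K}"
proof -
  have "{y\<in>Y. c y \<in> K} = (\<Union>\<kappa>\<in>K. {y\<in>Y. c y = \<kappa>})" by auto
  then show ?thesis using assms by (simp, subst card_UN_disjoint) auto
qed

text \<open>The limit is given only for classes in \<^const>\<open>ball_classes\<close>, and nothing is assumed about the
  measurability of the sets of points with a given class (junk measure \<open>0\<close>). Both problems are
  settled by the total mass: the finite sum of the frequencies of all classes is \<open>1\<close>, hence so is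
  the sum of their measures, so that almost every ball belongs to a class of \<^const>\<open>ball_classes\<close>
  with a measurable set of roots.\<close>

lemma eventually_frequency:
  fixes Y :: "nat \<Rightarrow> nat set" and B :: "(nat \<Rightarrow> bool) \<Rightarrow> 'v labeled_graph"
  assumes Y: "\<And>n. finite (Y n)" "\<And>n. Y n \<noteq> {}"
    and act: "\<And>n. group_action (free_group_fin r) (Y n) (\<alpha> n)" "\<And>n. lab n \<in> Y n \<rightarrow> bit_labels r"
    and B: "\<And>x. root (B x) \<in> verts (B x)"
    and lim: "\<And>\<kappa>. \<kappa> \<in> ball_classes r k \<Longrightarrow>
      (\<lambda>n. real (card {y \<in> Y n. iso_class (kball r k (\<alpha> n) (lab n) y) = \<kappa>}) / real (card (Y n)))
        \<longlonglongrightarrow> measure cantor_measure {x. iso_class (B x) = \<kappa>}"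
    and P: "{x. P x} \<in> sets cantor_measure"
    and PQ: "\<And>n x y. y \<in> Y n \<Longrightarrow> labeled_iso (B x) (kball r k (\<alpha> n) (lab n) y) \<Longrightarrow> P x \<Longrightarrow> Q n y"
    and e: "e < measure cantor_measure {x. P x}"
  shows "eventually (\<lambda>n. e < real (card {y \<in> Y n. Q n y}) / real (card (Y n))) sequentially"
proof -
  let ?\<mu> = "measure cantor_measure"
  define c where "c n y = iso_class (kball r k (\<alpha> n) (lab n) y)" for n y
  define S where "S \<kappa> = {x. iso_class (B x) = \<kappa>}" for \<kappa>
  define BC where "BC = ball_classes r k"
  have BC: "finite BC" by (simp add: BC_def finite_ball_classes)
  have freq: "(\<lambda>n. real (card {y \<in> Y n. c n y \<in> K}) / real (card (Y n))) \<longlonglongrightarrow> (\<Sum>\<kappa>\<in>K. ?\<mu> (S \<kappa>))"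
    if "K \<subseteq> BC" for K
  proof -
    have "(\<lambda>n. \<Sum>\<kappa>\<in>K. real (card {y \<in> Y n. c n y = \<kappa>}) / real (card (Y n)))
        \<longlonglongrightarrow> (\<Sum>\<kappa>\<in>K. ?\<mu> (S \<kappa>))"
      unfolding c_def S_def using that by (intro tendsto_sum lim) (auto simp: BC_def)
    moreover have "(\<Sum>\<kappa>\<in>K. real (card {y \<in> Y n. c n y = \<kappa>}) / real (card (Y n))) =
        real (card {y \<in> Y n. c n y \<in> K}) / real (card (Y n))" for n
      unfolding sum_card_fibers[OF Y(1) finite_subset[OF that BC], symmetric]
      by (simp add: sum_divide_distrib)
    ultimately show ?thesis by simp
  qed
  have "c n y \<in> BC" if "y \<in> Y n" for n y
    unfolding c_def BC_def ball_classes_def using act that by blast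
  then have "{y \<in> Y n. c n y \<in> BC} = Y n" for n by auto
  then have "(\<lambda>n. real (card {y \<in> Y n. c n y \<in> BC}) / real (card (Y n))) = (\<lambda>n. 1)"
    using Y by simp
  then have total: "(\<Sum>\<kappa>\<in>BC. ?\<mu> (S \<kappa>)) = 1"
    using freq[OF subset_refl] by (simp add: LIMSEQ_const_iff)
  define BM where "BM = {\<kappa>\<in>BC. S \<kappa> \<in> sets cantor_measure}"
  have meas_UN: "?\<mu> (\<Union>\<kappa>\<in>K. S \<kappa>) = (\<Sum>\<kappa>\<in>K. ?\<mu> (S \<kappa>))" if "K \<subseteq> BM" for K
  proof (rule cantor.finite_measure_finite_Union)
    show "finite K" using that BC by (auto simp: BM_def intro: finite_subset)
    show "disjoint_family_on S K" by (auto simp: disjoint_family_on_def S_def)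
  qed (use that in \<open>auto simp: BM_def\<close>)
  have "(\<Sum>\<kappa>\<in>BM. ?\<mu> (S \<kappa>)) = (\<Sum>\<kappa>\<in>BC. ?\<mu> (S \<kappa>))"
    using BC by (intro sum.mono_neutral_left) (auto simp: BM_def measure_notin_sets)
  with total have "?\<mu> (\<Union>\<kappa>\<in>BM. S \<kappa>) = 1"
    by (simp add: meas_UN)
  moreover have U: "(\<Union>\<kappa>\<in>BM. S \<kappa>) \<in> sets cantor_measure"
    using BC by (intro sets.finite_UN) (auto simp: BM_def)
  ultimately have AE_U: "AE x in cantor_measure. x \<in> (\<Union>\<kappa>\<in>BM. S \<kappa>)"
    by (simp add: cantor.prob_eq_1)
  \<comment> \<open>The classes that force \<open>Q\<close> wherever they occur in the finite
    actions. By \<open>PQ\<close>, a class of \<open>BC\<close> that is realised by some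
    \<open>x\<close> with \<open>P x\<close> belongs to \<open>K\<close>.\<close>
  define K where "K = {\<kappa>\<in>BC. \<forall>n. \<forall>y\<in>Y n. c n y = \<kappa> \<longrightarrow> Q n y}"
  have "?\<mu> {x. P x} \<le> ?\<mu> (\<Union>\<kappa>\<in>K \<inter> BM. S \<kappa>)"
  proof (rule cantor.finite_measure_mono_AE)
    show "(\<Union>\<kappa>\<in>K \<inter> BM. S \<kappa>) \<in> sets cantor_measure"
      using BC by (intro sets.finite_UN) (auto simp: BM_def)
    show "AE x in cantor_measure. x \<in> {x. P x} \<longrightarrow> x \<in> (\<Union>\<kappa>\<in>K \<inter> BM. S \<kappa>)"
      using AE_U
    proof eventually_elim
      fix x assume x: "x \<in> (\<Union>\<kappa>\<in>BM. S \<kappa>)"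
      show "x \<in> {x. P x} \<longrightarrow> x \<in> (\<Union>\<kappa>\<in>K \<inter> BM. S \<kappa>)"
      proof
        assume "x \<in> {x. P x}"
        then have "P x" by simp
        have "iso_class (B x) \<in> K"
          unfolding K_def
        proof (intro CollectI conjI allI ballI impI)
          show "iso_class (B x) \<in> BC" using x by (auto simp: BM_def S_def)
          fix n y assume y: "y \<in> Y n" and eq: "c n y = iso_class (B x)"
          have "labeled_iso (kball r k (\<alpha> n) (lab n) y) (B x)"
            using eq iso_class_eq_iff[OF finite_kball root_in_kball[OF act(1) y] B]
            by (simp add: c_def)
          then have "labeled_iso (B x) (kball r k (\<alpha> n) (lab n) y)"
            by (rule labeled_iso_sym) (rule root_in_kball[OF act(1) y])
          then show "Q n y" using PQ[OF y] \<open>P x\<close> by blast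
        qed
        with x show "x \<in> (\<Union>\<kappa>\<in>K \<inter> BM. S \<kappa>)" by (auto simp: S_def)
      qed
    qed
  qed
  also have "\<dots> = (\<Sum>\<kappa>\<in>K \<inter> BM. ?\<mu> (S \<kappa>))" by (rule meas_UN) auto
  also have "\<dots> \<le> (\<Sum>\<kappa>\<in>K. ?\<mu> (S \<kappa>))"
    using BC by (intro sum_mono2) (auto simp: K_def)
  finally have "e < (\<Sum>\<kappa>\<in>K. ?\<mu> (S \<kappa>))" using e by simp
  moreover have "K \<subseteq> BC" by (auto simp: K_def)
  ultimately have "eventually (\<lambda>n. e < real (card {y \<in> Y n. c n y \<in> K}) / real (card (Y n))) sequentially"
    using order_tendstoD(1)[OF freq] by blast
  then show ?thesis
  proof eventually_elim
    fix n assume "e < real (card {y \<in> Y n. c n y \<in> K}) / real (card (Y n))"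
    also have "\<dots> \<le> real (card {y \<in> Y n. Q n y}) / real (card (Y n))"
      using Y by (intro divide_right_mono of_nat_mono card_mono) (auto simp: K_def)
    finally show "e < real (card {y \<in> Y n. Q n y}) / real (card (Y n))" .
  qed
qed

section \<open>Cylinder approximation\<close>

lemma measurable_cantor_coordinate [measurable]:
  "(\<lambda>x. x i) \<in> measurable cantor_measure (count_space UNIV)"
proof -
  have "(\<lambda>x. x i) \<in> measurable cantor_measure (measure_pmf (bernoulli_pmf (1 / 2)))"
    unfolding cantor_measure_def by (rule measurable_component_singleton) simp
  then show ?thesis by (simp add: measurable_def)
qed

text \<open>Equality of points is a countable conjunction over the coordinates.\<close>

lemma sets_cantor_eq:
  assumes "f \<in> measurable cantor_measure cantor_measure" "g \<in> measurable cantor_measure cantor_measure"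
  shows "{x. f x = g x} \<in> sets cantor_measure"
proof -
  have [measurable]: "(\<lambda>x. f x i) \<in> measurable cantor_measure (count_space UNIV)"
    "(\<lambda>x. g x i) \<in> measurable cantor_measure (count_space UNIV)" for i
    using measurable_compose[OF _ measurable_cantor_coordinate] assms by auto
  have "{x. f x = g x} = {x\<in>space cantor_measure. \<forall>i. f x i = g x i}"
    by auto
  also have "\<dots> \<in> sets cantor_measure" by measurable
  finally show ?thesis .
qed

lemma sets_cantor_neq:
  assumes "f \<in> measurable cantor_measure cantor_measure" "g \<in> measurable cantor_measure cantor_measure"
  shows "{x. f x \<noteq> g x} \<in> sets cantor_measure"
proof -
  have "space cantor_measure - {x. f x = g x} \<in> sets cantor_measure"
    using sets_cantor_eq[OF assms] by blast
  moreover have "space cantor_measure - {x. f x = g x} = {x. f x \<noteq> g x}" by auto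
  ultimately show ?thesis by simp
qed

text \<open>Only finitely many restrictions occur, so each preimage is a finite union of cylinders,
  whatever \<open>f\<close> is.\<close>

lemma measurable_cantor_restrict:
  "(\<lambda>x. f (restrict x {..<r})) \<in> measurable cantor_measure (count_space UNIV)"
proof (rule measurableI)
  fix B
  let ?C = "{c \<in> {..<r} \<rightarrow>\<^sub>E UNIV. f c \<in> B}"
  have "(\<lambda>x. f (restrict x {..<r})) -` B \<inter> space cantor_measure = (\<Union>c\<in>?C. {x. \<forall>i\<in>{..<r}. x i = c i})"
  proof (intro Set.set_eqI iffI)
    fix x assume "x \<in> (\<lambda>x. f (restrict x {..<r})) -` B \<inter> space cantor_measure"
    then show "x \<in> (\<Union>c\<in>?C. {x. \<forall>i\<in>{..<r}. x i = c i})"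
      by (intro UN_I[of "restrict x {..<r}"]) auto
  next
    fix x assume "x \<in> (\<Union>c\<in>?C. {x. \<forall>i\<in>{..<r}. x i = c i})"
    then obtain c where c: "\<forall>i\<in>{..<r}. x i = c i" "c \<in> {..<r} \<rightarrow>\<^sub>E UNIV" "f c \<in> B" by blast
    then have "restrict x {..<r} = c"
      by (auto simp: fun_eq_iff PiE_iff extensional_def)
    with c show "x \<in> (\<lambda>x. f (restrict x {..<r})) -` B \<inter> space cantor_measure" by simp
  qed
  also have "\<dots> \<in> sets cantor_measure"
  proof (rule sets.finite_UN)
    show "finite ?C" by (rule finite_subset[of _ "{..<r} \<rightarrow>\<^sub>E UNIV"]) (auto intro!: finite_PiE)
    fix c
    have "{x \<in> space cantor_measure. \<forall>i\<in>{..<r}. x i = c i} \<in> sets cantor_measure" by measurable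
    then show "{x. \<forall>i\<in>{..<r}. x i = c i} \<in> sets cantor_measure" by simp
  qed
  finally show "(\<lambda>x. f (restrict x {..<r})) -` B \<inter> space cantor_measure \<in> sets cantor_measure" .
qed simp

lemma sets_cantor_symm_diff_cylinder:
  assumes "A \<in> sets cantor_measure"
  shows "{x. (x \<in> A) \<noteq> (restrict x {..<r} \<in> C)} \<in> sets cantor_measure"
proof -
  have "{x. restrict x {..<r} \<in> C} \<in> sets cantor_measure"
    using measurable_sets[OF measurable_cantor_restrict[of "\<lambda>c. c \<in> C" r], of "{True}"] by (simp add: vimage_def)
  moreover have "{x. (x \<in> A) \<noteq> (restrict x {..<r} \<in> C)} =
      (A - {x. restrict x {..<r} \<in> C}) \<union> ({x. restrict x {..<r} \<in> C} - A)" by auto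
  ultimately show ?thesis using assms by simp
qed

lemma restrict_restrict_lessThan:
  "m \<le> n \<Longrightarrow> restrict (restrict x {..<n}) {..<m} = restrict x {..<m :: nat}"
  by (auto simp: fun_eq_iff restrict_def)

text \<open>The sets that cylinders approximate form a \<sigma>-algebra containing the coordinate
  events. Complements leave the symmetric difference unchanged; a countable union is cut off at a
  finite stage by continuity of the measure, and the finitely many remaining sets are approximated
  one by one.\<close>

lemma cylinder_approx:
  assumes "A \<in> sets cantor_measure" "0 < \<delta>"
  shows "\<exists>r C. measure cantor_measure {x. (x \<in> A) \<noteq> (restrict x {..<r} \<in> C)} < \<delta>"
proof -
  let ?\<mu> = "measure cantor_measure" and ?M = "\<lambda>_. measure_pmf (bernoulli_pmf (1 / 2))"
  have eq: "sets cantor_measure = sigma_sets (\<Pi>\<^sub>E i\<in>UNIV. space (?M i))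
      {{f\<in>\<Pi>\<^sub>E i\<in>UNIV. space (?M i). f i \<in> A} | i A. i \<in> UNIV \<and> A \<in> sets (?M i)}"
    unfolding cantor_measure_def by (rule sets_PiM_single)
  show ?thesis
    using assms unfolding eq
  proof (induction arbitrary: \<delta> rule: sigma_sets.induct)
    case (Basic a)
    then obtain i :: nat and B where a: "a = {f. f i \<in> B}" by auto
    \<comment> \<open>Coordinate \<open>i\<close> survives restriction to the first
      \<open>Suc i\<close> coordinates, so the approximation is exact.\<close>
    have "{x. (x \<in> a) \<noteq> (restrict x {..<Suc i} \<in> {c. c i \<in> B})} = {}" by (auto simp: a)
    with Basic show ?case
      by (intro exI[of _ "Suc i"] exI[of _ "{c. c i \<in> B}"]) simp
  next
    case Empty
    then show ?case by (intro exI[of _ 0] exI[of _ "{}"]) simp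
  next
    case (Compl a)
    then obtain r C where "?\<mu> {x. (x \<in> a) \<noteq> (restrict x {..<r} \<in> C)} < \<delta>" by blast
    moreover have "{x. (x \<in> (\<Pi>\<^sub>E i\<in>UNIV. space (?M i)) - a) \<noteq> (restrict x {..<r} \<in> - C)} =
        {x. (x \<in> a) \<noteq> (restrict x {..<r} \<in> C)}" by auto
    ultimately show ?case by (intro exI[of _ r] exI[of _ "- C"]) (simp only:)
  next
    case (Union A)
    have A: "A i \<in> sets cantor_measure" for i unfolding eq by (rule Union.hyps)
    define D where "D n = (\<Union>i<n. A i)" for n :: nat
    have D: "D n \<in> sets cantor_measure" for n using A by (auto simp: D_def)
    have "incseq D" unfolding incseq_def D_def by (intro allI impI UN_mono) auto
    then have "(\<lambda>n. ?\<mu> (D n)) \<longlonglongrightarrow> ?\<mu> (\<Union>n. D n)"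
      using D by (intro cantor.finite_Lim_measure_incseq) auto
    moreover have "(\<Union>n. D n) = (\<Union>i. A i)" by (auto simp: D_def)
    ultimately have "eventually (\<lambda>n. ?\<mu> (\<Union>i. A i) - \<delta> / 2 < ?\<mu> (D n)) sequentially"
      using Union.prems by (intro order_tendstoD(1)) auto
    then obtain N where N: "?\<mu> (\<Union>i. A i) - \<delta> / 2 < ?\<mu> (D N)"
      by (auto simp: eventually_sequentially)
    have "?\<mu> ((\<Union>i. A i) - D N) = ?\<mu> (\<Union>i. A i) - ?\<mu> (D N)"
      using A D by (intro cantor.finite_measure_Diff) (auto simp: D_def)
    with N have N': "?\<mu> ((\<Union>i. A i) - D N) < \<delta> / 2" by simp
    \<comment> \<open>The tail uses half of \<delta>; the other half is shared by \<open>N\<close>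
      sets, and the added \<open>1\<close> avoids division by zero.\<close>
    define \<eta> where "\<eta> = \<delta> / (2 * (real N + 1))"
    have "\<eta> > 0" using Union.prems by (simp add: \<eta>_def)
    then have "\<forall>i. \<exists>r C. ?\<mu> {x. (x \<in> A i) \<noteq> (restrict x {..<r} \<in> C)} < \<eta>"
      using Union.IH by blast
    then obtain r C where rC: "\<And>i. ?\<mu> {x. (x \<in> A i) \<noteq> (restrict x {..<r i} \<in> C i)} < \<eta>"
      by metis
    \<comment> \<open>The sum is merely a convenient common bound for the finitely many
      \<open>r i\<close>.\<close>
    define R where "R = (\<Sum>i<N. r i)"
    have R: "r i \<le> R" if "i < N" for i unfolding R_def using that by (intro member_le_sum) auto
    define C' where "C' = {c. \<exists>i<N. restrict c {..<r i} \<in> C i}"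
    let ?E = "\<lambda>i. {x. (x \<in> A i) \<noteq> (restrict x {..<r i} \<in> C i)}"
    have E: "?E i \<in> sets cantor_measure" for i by (rule sets_cantor_symm_diff_cylinder[OF A])
    have C': "restrict x {..<R} \<in> C' \<longleftrightarrow> (\<exists>i<N. restrict x {..<r i} \<in> C i)" for x
      unfolding C'_def mem_Collect_eq using R by (metis restrict_restrict_lessThan)
    have "{x. (x \<in> (\<Union>i. A i)) \<noteq> (restrict x {..<R} \<in> C')} \<subseteq> ((\<Union>i. A i) - D N) \<union> (\<Union>i<N. ?E i)"
      unfolding C' D_def by blast
    then have "?\<mu> {x. (x \<in> (\<Union>i. A i)) \<noteq> (restrict x {..<R} \<in> C')} \<le>
        ?\<mu> (((\<Union>i. A i) - D N) \<union> (\<Union>i<N. ?E i))"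
      using A D E by (intro cantor.finite_measure_mono) auto
    also have "\<dots> \<le> ?\<mu> ((\<Union>i. A i) - D N) + ?\<mu> (\<Union>i<N. ?E i)"
      using A D E by (intro measure_Un_le) auto
    also have "?\<mu> (\<Union>i<N. ?E i) \<le> (\<Sum>i<N. ?\<mu> (?E i))"
      using E by (intro measure_UNION_le) auto
    also have "\<dots> \<le> (\<Sum>i<N. \<eta>)" by (intro sum_mono less_imp_le rC)
    also have "\<dots> \<le> \<delta> / 2" using Union.prems by (simp add: \<eta>_def field_simps)
    finally have "?\<mu> {x. (x \<in> (\<Union>i. A i)) \<noteq> (restrict x {..<R} \<in> C')} < \<delta>"
      using N' by simp
    then show ?case by blast
  qed
qed

text \<open>Values of \<open>h\<close> with large index occur with small probability, and the level
  sets of the remaining ones are replaced by cylinders. Keeping the range inside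
  \<open>range h\<close> ensures that approximating a word-valued \<open>h\<close> yields genuine
  reduced words.\<close>

lemma cylinder_code_approx:
  fixes h :: "(nat \<Rightarrow> bool) \<Rightarrow> 'a::countable"
  assumes h: "h \<in> measurable cantor_measure (count_space UNIV)" and "0 < \<delta>"
  shows "\<exists>r code. finite (range code) \<and> range code \<subseteq> range h \<and>
    measure cantor_measure {x. h x \<noteq> code (restrict x {..<r})} < \<delta>"
proof -
  let ?\<mu> = "measure cantor_measure"
  have hs: "{x. h x \<in> B} \<in> sets cantor_measure" for B
    using measurable_sets[OF h, of B] by (simp add: vimage_def)
  define E where "E n = {x. n \<le> to_nat (h x)}" for n
  have Es: "E n \<in> sets cantor_measure" for n
    using hs[of "{v. n \<le> to_nat v}"] by (simp add: E_def)
  have "decseq E" by (auto simp: decseq_def E_def)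
  then have "(\<lambda>n. ?\<mu> (E n)) \<longlonglongrightarrow> ?\<mu> (\<Inter>n. E n)"
    using Es by (intro cantor.finite_Lim_measure_decseq) auto
  moreover have "(\<Inter>n. E n) = {}" by (auto simp: E_def) (meson not_less_eq_eq order_refl)
  ultimately have "eventually (\<lambda>n. ?\<mu> (E n) < \<delta> / 2) sequentially"
    using \<open>0 < \<delta>\<close> by (intro order_tendstoD(2)) auto
  then obtain N where N: "?\<mu> (E N) < \<delta> / 2" by (auto simp: eventually_sequentially)
  define \<eta> where "\<eta> = \<delta> / (2 * (real N + 1))"
  have "\<eta> > 0" using \<open>0 < \<delta>\<close> by (simp add: \<eta>_def)
  define A where "A i = {x. to_nat (h x) = i}" for i
  have A: "A i \<in> sets cantor_measure" for i
    using hs[of "{v. to_nat v = i}"] by (simp add: A_def)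
  have "\<forall>i. \<exists>r C. ?\<mu> {x. (x \<in> A i) \<noteq> (restrict x {..<r} \<in> C)} < \<eta>"
    using cylinder_approx[OF A \<open>\<eta> > 0\<close>] by blast
  then obtain r C where rC: "\<And>i. ?\<mu> {x. (x \<in> A i) \<noteq> (restrict x {..<r i} \<in> C i)} < \<eta>"
    by metis
  define R where "R = (\<Sum>i<N. r i)"
  have R: "r i \<le> R" if "i < N" for i unfolding R_def using that by (intro member_le_sum) auto
  \<comment> \<open>The condition on \<open>range\<close> makes \<open>from_nat i\<close> a value of
    \<open>h\<close> for every good \<open>i\<close>.\<close>
  define good where "good c i \<longleftrightarrow> i < N \<and> i \<in> range (\<lambda>x. to_nat (h x)) \<and> restrict c {..<r i} \<in> C i" for c i
  \<comment> \<open>The cylinders may overlap or miss a point, so the least good index is taken,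
    with a value of \<open>h\<close> as default.\<close>
  define code where "code c = (if \<exists>i. good c i then from_nat (LEAST i. good c i) else h undefined)" for c
  have goodD: "good c (LEAST i. good c i)" if "good c i" for c i using that by (rule LeastI)
  let ?E = "\<lambda>i. {x. (x \<in> A i) \<noteq> (restrict x {..<r i} \<in> C i)}"
  have E: "?E i \<in> sets cantor_measure" for i by (rule sets_cantor_symm_diff_cylinder[OF A])
  have sub: "{x. h x \<noteq> code (restrict x {..<R})} \<subseteq> E N \<union> (\<Union>i<N. ?E i)"
  proof (rule subsetI, rule ccontr)
    fix x assume x: "x \<in> {x. h x \<noteq> code (restrict x {..<R})}" "x \<notin> E N \<union> (\<Union>i<N. ?E i)"
    \<comment> \<open>Outside the exceptional sets the cylinders decide the level sets correctly, so
      the index of \<open>h x\<close> is the only good one.\<close>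
    have good: "good (restrict x {..<R}) i \<longleftrightarrow> i = to_nat (h x)" for i
    proof (cases "i < N")
      case True
      then have "x \<in> A i \<longleftrightarrow> restrict x {..<r i} \<in> C i" using x(2) by blast
      then show ?thesis using True
        unfolding good_def restrict_restrict_lessThan[OF R[OF True]] by (auto simp: A_def)
    qed (use x(2) in \<open>auto simp: good_def E_def\<close>)
    then have g: "good (restrict x {..<R}) = (\<lambda>i. i = to_nat (h x))" by (auto simp: fun_eq_iff)
    have "(LEAST i. i = to_nat (h x)) = to_nat (h x)" by (intro Least_equality) auto
    then have "code (restrict x {..<R}) = h x" unfolding code_def g by simp
    with x(1) show False by simp
  qed
  have "?\<mu> {x. h x \<noteq> code (restrict x {..<R})} \<le> ?\<mu> (E N \<union> (\<Union>i<N. ?E i))"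
    using Es E by (intro cantor.finite_measure_mono sub) auto
  also have "\<dots> \<le> ?\<mu> (E N) + ?\<mu> (\<Union>i<N. ?E i)"
    using Es E by (intro measure_Un_le) auto
  also have "?\<mu> (\<Union>i<N. ?E i) \<le> (\<Sum>i<N. ?\<mu> (?E i))"
    using E by (intro measure_UNION_le) auto
  also have "\<dots> \<le> (\<Sum>i<N. \<eta>)" by (intro sum_mono less_imp_le rC)
  also have "\<dots> \<le> \<delta> / 2" using \<open>0 < \<delta>\<close> by (simp add: \<eta>_def field_simps)
  finally have "?\<mu> {x. h x \<noteq> code (restrict x {..<R})} < \<delta>" using N by simp
  moreover have "range code \<subseteq> from_nat ` {..<N} \<union> {h undefined}"
  proof (rule image_subsetI)
    fix c
    show "code c \<in> from_nat ` {..<N} \<union> {h undefined}"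
    proof (cases "\<exists>i. good c i")
      case True
      then have "(LEAST i. good c i) < N" using goodD unfolding good_def by blast
      with True show ?thesis by (simp add: code_def)
    qed (simp add: code_def)
  qed
  then have "finite (range code)" by (rule finite_subset) auto
  moreover have "range code \<subseteq> range h"
  proof (rule image_subsetI)
    fix c
    show "code c \<in> range h"
    proof (cases "\<exists>i. good c i")
      case True
      then obtain x where "(LEAST i. good c i) = to_nat (h x)"
        using goodD by (fastforce simp: good_def)
      with True show ?thesis by (simp add: code_def)
    qed (simp add: code_def)
  qed
  ultimately show ?thesis by blast
qed

section \<open>The full group of an orbit relation\<close>

lemma countable_carrier_free_group: "countable (carrier (free_group I))"
  by (rule countable_subset[OF subset_UNIV]) simp

lemma pmp_action_measurable:
  "pmp_action \<Phi> \<Longrightarrow> w \<in> carrier free_group_inf \<Longrightarrow> \<Phi> w \<in> measurable cantor_measure cantor_measure"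
  by (simp add: pmp_action_def)

text \<open>Words are countable, so the first one in a fixed enumeration that carries
  \<open>x\<close> to \<open>T x\<close> can be taken; it depends measurably on \<open>x\<close>
  because each set where \<open>T\<close> agrees with a given word is Borel.\<close>

lemma full_group_selector:
  assumes \<Phi>: "pmp_action \<Phi>" and T: "T \<in> carrier (borel_full_group (orbit_relation \<Phi>))"
  shows "\<exists>h \<in> measurable cantor_measure (count_space UNIV).
    \<forall>x. h x \<in> carrier free_group_inf \<and> T x = \<Phi> (h x) x"
proof -
  interpret group_action free_group_inf UNIV \<Phi> using \<Phi> by (simp add: pmp_action_def)
  have Tm: "T \<in> measurable cantor_measure cantor_measure" using T by (simp add: borel_full_group_def)
  define P where "P n x \<longleftrightarrow> (from_nat n :: letter list) \<in> carrier free_group_inf \<and> T x = \<Phi> (from_nat n) x"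
    for n x
  have [measurable]: "(\<lambda>x. P n x) \<in> measurable cantor_measure (count_space UNIV)" for n
  proof (cases "(from_nat n :: letter list) \<in> carrier free_group_inf")
    case True
    then have "{x \<in> space cantor_measure. P n x} \<in> sets cantor_measure"
      unfolding P_def using sets_cantor_eq[OF Tm pmp_action_measurable[OF \<Phi> True]] by simp
    then show ?thesis by (simp only: pred_def)
  qed (simp add: P_def)
  have ex: "\<exists>n. P n x" for x
  proof -
    have "(T x, x) \<in> orbit_relation \<Phi>" using T by (simp add: borel_full_group_def)
    then obtain w where w: "w \<in> carrier free_group_inf" "\<Phi> w (T x) = x"
      by (auto simp: orbit_relation_def)
    \<comment> \<open>The relation supplies a word from \<open>T x\<close> back to \<open>x\<close>;
      the selector needs the opposite direction.\<close>
    let ?v = "inv\<^bsub>free_group_inf\<^esub> w"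
    have "?v \<in> carrier free_group_inf" by (intro group.inv_closed group_free_group w)
    moreover have "\<Phi> ?v x = T x" using orbit_sym_aux[OF w(1) _ w(2)] by simp
    ultimately show ?thesis by (intro exI[of _ "to_nat ?v"]) (simp add: P_def)
  qed
  have "(\<lambda>x. LEAST n. P n x) \<in> measurable cantor_measure (count_space UNIV)" by measurable
  then have "(\<lambda>x. from_nat (LEAST n. P n x) :: letter list) \<in> measurable cantor_measure (count_space UNIV)"
    by (rule measurable_compose) simp
  moreover have "P (LEAST n. P n x) x" for x using ex LeastI_ex by metis
  ultimately show ?thesis
    by (intro bexI[of _ "\<lambda>x. from_nat (LEAST n. P n x)"]) (auto simp: P_def)
qed

text \<open>A countable gluing of the measurable maps \<open>\<Phi> w\<close> along the level sets
  of \<open>h\<close>.\<close>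

lemma measurable_apply_code:
  assumes \<Phi>: "pmp_action \<Phi>"
    and h: "h \<in> measurable cantor_measure (count_space UNIV)"
    and c: "\<And>x. h x \<in> carrier free_group_inf"
  shows "(\<lambda>x. \<Phi> (h x) x) \<in> measurable cantor_measure cantor_measure"
proof (rule measurable_compose_countable'[where I = "carrier free_group_inf"])
  show "\<Phi> w \<in> measurable cantor_measure cantor_measure" if "w \<in> carrier free_group_inf" for w
    by (rule pmp_action_measurable[OF \<Phi> that])
  show "h \<in> measurable cantor_measure (count_space (carrier free_group_inf))"
    using h c measurable_sets[OF h]
    by (auto simp: measurable_count_space_eq_countable[OF countable_carrier_free_group])
qed (rule countable_carrier_free_group)

text \<open>On the set where \<open>T\<close> acts by \<open>w\<close>, the preimage of \<open>B\<close> under \<open>T\<close> is the preimage under \<open>\<Phi> w\<close>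
  of the corresponding part of \<open>B\<close>.\<close>

lemma full_group_preserves_measure:
  assumes \<Phi>: "pmp_action \<Phi>" and T: "T \<in> carrier (borel_full_group (orbit_relation \<Phi>))"
  shows "distr cantor_measure cantor_measure T = cantor_measure"
proof (rule measure_eqI)
  fix B assume "B \<in> sets (distr cantor_measure cantor_measure T)"
  then have B: "B \<in> sets cantor_measure" by simp
  interpret group_action free_group_inf UNIV \<Phi> using \<Phi> by (simp add: pmp_action_def)
  let ?S = "inv_into UNIV T"
  have Tm: "T \<in> measurable cantor_measure cantor_measure"
    and Sm: "?S \<in> measurable cantor_measure cantor_measure" and "bij T"
    using T by (auto simp: borel_full_group_def)
  have ST: "?S (T x) = x" "T (?S x) = x" for x
    using \<open>bij T\<close> by (simp_all add: bij_is_inj bij_is_surj surj_f_inv_f)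
  obtain h where h: "h \<in> measurable cantor_measure (count_space UNIV)"
    and hT: "\<And>x. h x \<in> carrier free_group_inf" "\<And>x. T x = \<Phi> (h x) x"
    using full_group_selector[OF \<Phi> T] by blast
  define A where "A n = {x. to_nat (h x) = n}" for n
  have A: "A n \<in> sets cantor_measure" for n
    using measurable_sets[OF h, of "{v. to_nat v = n}"] by (simp add: A_def vimage_def)
  have disj: "disjoint_family A" by (auto simp: disjoint_family_on_def A_def)
  have "(\<Union>n. A n) = UNIV" by (auto simp: A_def)
  have TB: "T -` B \<in> sets cantor_measure" using measurable_sets[OF Tm B] by simp
  have SA: "?S -` A n \<in> sets cantor_measure" for n using measurable_sets[OF Sm A] by simp
  \<comment> \<open>A number that is not the code of a reduced word has an empty level set, which
    settles the second case.\<close>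
  have piece: "emeasure cantor_measure (T -` B \<inter> A n) = emeasure cantor_measure (B \<inter> ?S -` A n)" for n
  proof (cases "(from_nat n :: letter list) \<in> carrier free_group_inf \<and> to_nat (from_nat n :: letter list) = n")
    case True
    define w :: "letter list" where "w = from_nat n"
    have w: "w \<in> carrier free_group_inf" "to_nat w = n" using True by (auto simp: w_def)
    have hw: "x \<in> A n \<longleftrightarrow> h x = w" for x using w(2) by (auto simp: A_def)
    have "T -` B \<inter> A n = \<Phi> w -` (B \<inter> ?S -` A n)"
    proof (intro Set.set_eqI iffI)
      fix x assume "x \<in> T -` B \<inter> A n"
      moreover from this have "\<Phi> w x = T x" using hT(2)[of x] hw by auto
      ultimately show "x \<in> \<Phi> w -` (B \<inter> ?S -` A n)" using ST by simp
    next
      fix x assume x: "x \<in> \<Phi> w -` (B \<inter> ?S -` A n)"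
      define z where "z = ?S (\<Phi> w x)"
      have "z \<in> A n" "T z = \<Phi> w x" using x ST by (auto simp: z_def)
      then have "\<Phi> w z = \<Phi> w x" using hT(2)[of z] hw by simp
      then have "z = x" using inj_prop[OF w(1)] by (simp add: inj_eq)
      with \<open>z \<in> A n\<close> \<open>T z = \<Phi> w x\<close> x show "x \<in> T -` B \<inter> A n" by auto
    qed
    moreover have "emeasure cantor_measure (\<Phi> w -` (B \<inter> ?S -` A n)) =
        emeasure (distr cantor_measure cantor_measure (\<Phi> w)) (B \<inter> ?S -` A n)"
      using pmp_action_measurable[OF \<Phi> w(1)] B SA by (subst emeasure_distr) auto
    ultimately show ?thesis using \<Phi> w(1) by (simp add: pmp_action_def)
  next
    case False
    then have "A n = {}" using hT(1) by (auto simp: A_def)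
    then show ?thesis by simp
  qed
  have "emeasure (distr cantor_measure cantor_measure T) B = emeasure cantor_measure (T -` B)"
    using Tm B by (simp add: emeasure_distr)
  also have "\<dots> = emeasure cantor_measure (\<Union>n. T -` B \<inter> A n)"
    using \<open>(\<Union>n. A n) = UNIV\<close> by (simp flip: Int_UN_distrib)
  also have "\<dots> = (\<Sum>n. emeasure cantor_measure (T -` B \<inter> A n))"
    using TB A disj by (intro suminf_emeasure[symmetric]) (auto simp: disjoint_family_on_def)
  also have "\<dots> = (\<Sum>n. emeasure cantor_measure (B \<inter> ?S -` A n))" by (simp add: piece)
  also have "\<dots> = emeasure cantor_measure (\<Union>n. B \<inter> ?S -` A n)"
    using B SA disj by (intro suminf_emeasure) (auto simp: disjoint_family_on_def)
  also have "(\<Union>n. B \<inter> ?S -` A n) = B" using \<open>(\<Union>n. A n) = UNIV\<close> by blast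
  finally show "emeasure (distr cantor_measure cantor_measure T) B = emeasure cantor_measure B" .
qed simp

text \<open>A measure-preserving map pulls null sets back to null sets.\<close>

lemma full_group_AE:
  assumes "pmp_action \<Phi>" "T \<in> carrier (borel_full_group (orbit_relation \<Phi>))"
    and "AE x in cantor_measure. P x"
  shows "AE x in cantor_measure. P (T x)"
proof -
  have T: "T \<in> measurable cantor_measure cantor_measure"
    using assms by (simp add: borel_full_group_def)
  have "AE x in distr cantor_measure cantor_measure T. P x"
    unfolding full_group_preserves_measure[OF assms(1,2)] by (rule assms(3))
  with T show ?thesis by (rule AE_distrD)
qed

section \<open>The Borel full group and its normal subgroup of almost everywhere trivial
  maps\<close>

lemma orbit_relation_refl:
  assumes "pmp_action \<Phi>" shows "(x, x) \<in> orbit_relation \<Phi>"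
  using assms group_action_Nil[of UNIV UNIV \<Phi> x] Nil_in_free_group
  unfolding orbit_relation_def pmp_action_def by fastforce

lemma orbit_relation_sym:
  assumes "pmp_action \<Phi>" "(x, y) \<in> orbit_relation \<Phi>" shows "(y, x) \<in> orbit_relation \<Phi>"
proof -
  interpret group_action free_group_inf UNIV \<Phi> using assms by (simp add: pmp_action_def)
  obtain w where w: "w \<in> carrier free_group_inf" "\<Phi> w x = y"
    using assms by (auto simp: orbit_relation_def)
  have "\<Phi> (inv\<^bsub>free_group_inf\<^esub> w) y = x" using orbit_sym_aux[OF w(1) _ w(2)] by simp
  moreover have "inv\<^bsub>free_group_inf\<^esub> w \<in> carrier free_group_inf"
    by (intro group.inv_closed group_free_group w)
  ultimately show ?thesis by (auto simp: orbit_relation_def)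
qed

lemma orbit_relation_trans:
  assumes "pmp_action \<Phi>" "(x, y) \<in> orbit_relation \<Phi>" "(y, z) \<in> orbit_relation \<Phi>"
  shows "(x, z) \<in> orbit_relation \<Phi>"
proof -
  interpret group_action free_group_inf UNIV \<Phi> using assms by (simp add: pmp_action_def)
  obtain v w where vw: "w \<in> carrier free_group_inf" "\<Phi> w x = y" "v \<in> carrier free_group_inf" "\<Phi> v y = z"
    using assms by (auto simp: orbit_relation_def)
  have "\<Phi> (v \<otimes>\<^bsub>free_group_inf\<^esub> w) x = z" using composition_rule[OF _ vw(3,1)] vw by simp
  moreover have "v \<otimes>\<^bsub>free_group_inf\<^esub> w \<in> carrier free_group_inf"
    by (intro monoid.m_closed group.is_monoid group_free_group vw)
  ultimately show ?thesis by (auto simp: orbit_relation_def)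
qed

lemma borel_full_group_simps:
  "S \<otimes>\<^bsub>borel_full_group E\<^esub> T = S \<circ> T" "\<one>\<^bsub>borel_full_group E\<^esub> = id"
  by (simp_all add: borel_full_group_def)

lemma inv_into_mem_borel_full_group:
  assumes "pmp_action \<Phi>" "T \<in> carrier (borel_full_group (orbit_relation \<Phi>))"
  shows "inv_into UNIV T \<in> carrier (borel_full_group (orbit_relation \<Phi>))"
proof -
  have T: "bij T" "T \<in> measurable cantor_measure cantor_measure"
    "inv_into UNIV T \<in> measurable cantor_measure cantor_measure" "\<And>x. (T x, x) \<in> orbit_relation \<Phi>"
    using assms by (auto simp: borel_full_group_def)
  have "(inv_into UNIV T x, x) \<in> orbit_relation \<Phi>" for x
    using orbit_relation_sym[OF assms(1) T(4)[of "inv_into UNIV T x"]] T(1)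
    by (simp add: bij_is_surj surj_f_inv_f)
  then show ?thesis using T by (simp add: borel_full_group_def bij_imp_bij_inv inv_inv_eq)
qed

lemma group_borel_full_group:
  assumes "pmp_action \<Phi>"
  shows "group (borel_full_group (orbit_relation \<Phi>))"
proof (rule groupI, unfold borel_full_group_simps)
  let ?G = "borel_full_group (orbit_relation \<Phi>)"
  fix S T assume ST: "S \<in> carrier ?G" "T \<in> carrier ?G"
  then have "(S (T x), x) \<in> orbit_relation \<Phi>" for x
    using orbit_relation_trans[OF assms, of "S (T x)" "T x" x] by (simp add: borel_full_group_def)
  with ST show "S \<circ> T \<in> carrier ?G"
    by (auto simp: borel_full_group_def bij_comp o_inv_distrib)
next
  show "id \<in> carrier (borel_full_group (orbit_relation \<Phi>))"
    using orbit_relation_refl[OF assms] by (simp add: borel_full_group_def)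
next
  fix T assume T: "T \<in> carrier (borel_full_group (orbit_relation \<Phi>))"
  then have "inv_into UNIV T \<circ> T = id" by (simp add: borel_full_group_def bij_is_inj)
  then show "\<exists>S\<in>carrier (borel_full_group (orbit_relation \<Phi>)). S \<circ> T = id"
    using inv_into_mem_borel_full_group[OF assms T] by blast
qed (simp_all only: comp_assoc id_comp)

text \<open>Conjugation is the step that uses invariance of the measure: the conjugate by
  \<open>S\<close> fixes \<open>x\<close> as soon as \<open>T\<close> fixes the preimage of
  \<open>x\<close> under \<open>S\<close>, and the exceptional \<open>x\<close> form the pullback of
  a null set.\<close>

lemma normal_ae_trivial:
  assumes "pmp_action \<Phi>"
  shows "ae_trivial (orbit_relation \<Phi>) \<lhd> borel_full_group (orbit_relation \<Phi>)"
proof -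
  let ?G = "borel_full_group (orbit_relation \<Phi>)" and ?N = "ae_trivial (orbit_relation \<Phi>)"
  interpret group ?G by (rule group_borel_full_group[OF assms])
  have inv: "inv\<^bsub>?G\<^esub> T = inv_into UNIV T" if "T \<in> carrier ?G" for T
    using that inv_into_mem_borel_full_group[OF assms that]
    by (intro inv_equality) (auto simp: borel_full_group_def bij_is_inj)
  have cancel: "inv_into UNIV T (T x) = x" "T (inv_into UNIV T x) = x" if "T \<in> carrier ?G" for T x
    using that by (simp_all add: borel_full_group_def bij_is_inj bij_is_surj surj_f_inv_f)
  have sub: "subgroup ?N ?G"
  proof (rule subgroupI)
    show "?N \<subseteq> carrier ?G" by (auto simp: ae_trivial_def)
    have "id \<in> ?N" using one_closed by (simp add: ae_trivial_def borel_full_group_simps)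
    then show "?N \<noteq> {}" by blast
  next
    fix T assume "T \<in> ?N"
    then have T: "T \<in> carrier ?G" "AE x in cantor_measure. T x = x" by (auto simp: ae_trivial_def)
    from T(2) have "AE x in cantor_measure. inv_into UNIV T x = x"
      by eventually_elim (metis cancel(1)[OF T(1)])
    then show "inv\<^bsub>?G\<^esub> T \<in> ?N"
      using inv[OF T(1)] inv_closed[OF T(1)] by (simp add: ae_trivial_def)
  next
    fix S T assume "S \<in> ?N" "T \<in> ?N"
    then have ST: "S \<in> carrier ?G" "T \<in> carrier ?G"
      and "AE x in cantor_measure. S x = x" "AE x in cantor_measure. T x = x"
      by (auto simp: ae_trivial_def)
    from this(3,4) have "AE x in cantor_measure. (S \<circ> T) x = x" by eventually_elim simp
    then show "S \<otimes>\<^bsub>?G\<^esub> T \<in> ?N"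
      using m_closed[OF ST] by (simp add: ae_trivial_def borel_full_group_simps)
  qed
  moreover have "S \<otimes>\<^bsub>?G\<^esub> T \<otimes>\<^bsub>?G\<^esub> inv\<^bsub>?G\<^esub> S \<in> ?N" if S: "S \<in> carrier ?G" and "T \<in> ?N" for S T
  proof -
    have T: "T \<in> carrier ?G" "AE x in cantor_measure. T x = x" using that by (auto simp: ae_trivial_def)
    have "AE x in cantor_measure. T (inv_into UNIV S x) = inv_into UNIV S x"
      by (rule full_group_AE[OF assms inv_into_mem_borel_full_group[OF assms S] T(2)])
    then have "AE x in cantor_measure. (S \<circ> T \<circ> inv_into UNIV S) x = x"
      by eventually_elim (simp add: cancel[OF S])
    then show ?thesis
      using m_closed[OF m_closed[OF S T(1)] inv_closed[OF S]]
      by (simp add: ae_trivial_def borel_full_group_simps inv[OF S])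
  qed
  ultimately show ?thesis unfolding normal_inv_iff by blast
qed

text \<open>Allowing every \<open>r\<close> above \<open>r0\<close> lets finitely many elements
  share one number of bits. The identity gets the empty word everywhere because a sofic
  approximation must send it exactly to the identity.\<close>

lemma full_group_code:
  assumes \<Phi>: "pmp_action \<Phi>" and T: "T \<in> carrier (borel_full_group (orbit_relation \<Phi>))" and "0 < \<delta>"
  shows "\<exists>r0. \<forall>r\<ge>r0. \<exists>code. (\<forall>z. code z \<in> short_words r r0) \<and> (T = id \<longrightarrow> code = (\<lambda>_. [])) \<and>
    measure cantor_measure {x. T x \<noteq> \<Phi> (code (restrict x {..<r})) x} < \<delta>"
proof (cases "T = id")
  case True
  have "\<Phi> [] x = x" for x using group_action_Nil[of UNIV UNIV \<Phi> x] \<Phi> by (simp add: pmp_action_def)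
  with True show ?thesis using \<open>0 < \<delta>\<close>
    by (intro exI[of _ 0] allI impI exI[of _ "\<lambda>_. []"]) simp
next
  case False
  obtain h where h: "h \<in> measurable cantor_measure (count_space UNIV)"
    and hT: "\<And>x. h x \<in> carrier free_group_inf" "\<And>x. T x = \<Phi> (h x) x"
    using full_group_selector[OF \<Phi> T] by blast
  obtain r code where code: "finite (range code)" "range code \<subseteq> range h"
    "measure cantor_measure {x. h x \<noteq> code (restrict x {..<r})} < \<delta>"
    using cylinder_code_approx[OF h \<open>0 < \<delta>\<close>] by blast
  obtain m k where mk: "range code \<subseteq> short_words m k"
  proof -
    have "range code \<subseteq> carrier free_group_inf"
      using code(2) hT(1) by (metis (no_types, lifting) image_subset_iff rangeE subset_iff)
    then show thesis using finite_subset_short_words[OF code(1)] that by blast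
  qed
  \<comment> \<open>A single bound for the bits read, the generators used and the lengths of the
    words.\<close>
  define r0 where "r0 = max r (max m k)"
  have "\<exists>code. (\<forall>z. code z \<in> short_words r' r0) \<and> (T = id \<longrightarrow> code = (\<lambda>_. [])) \<and>
      measure cantor_measure {x. T x \<noteq> \<Phi> (code (restrict x {..<r'})) x} < \<delta>" if "r0 \<le> r'" for r'
  proof (intro exI[of _ "\<lambda>z. code (restrict z {..<r})"] conjI allI impI)
    fix z
    have "short_words m k \<subseteq> short_words r' r0"
      by (rule short_words_mono) (use that in \<open>auto simp: r0_def\<close>)
    with mk show "code (restrict z {..<r}) \<in> short_words r' r0" by blast
  next
    have r: "r \<le> r'" using that by (simp add: r0_def)
    have "(\<lambda>x. h x \<noteq> code (restrict x {..<r})) \<in> measurable cantor_measure (count_space UNIV)"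
      by (rule measurable_compose_countable[OF _ h, of "\<lambda>v x. v \<noteq> code (restrict x {..<r})"])
        (rule measurable_cantor_restrict)
    from measurable_sets[OF this, of "{True}"]
    have "{x. h x \<noteq> code (restrict x {..<r})} \<in> sets cantor_measure" by (simp add: vimage_def)
    then have "measure cantor_measure {x. T x \<noteq> \<Phi> (code (restrict (restrict x {..<r'}) {..<r})) x} \<le>
        measure cantor_measure {x. h x \<noteq> code (restrict x {..<r})}"
      unfolding restrict_restrict_lessThan[OF r]
      by (intro cantor.finite_measure_mono) (auto simp: hT(2))
    with code(3) show "measure cantor_measure
        {x. T x \<noteq> \<Phi> (code (restrict (restrict x {..<r'}) {..<r})) x} < \<delta>" by simp
  qed (use False in simp)
  then show ?thesis by blast
qed

section \<open>From sofic actions to sofic approximations\<close>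

text \<open>Formulated for Borel maps, so that representatives of cosets can be inserted later;
  these multiply only almost everywhere, hence the form of the second clause.\<close>

lemma sofic_approximation:
  assumes \<Phi>: "sofic_action \<Phi>" and I: "finite I" "I \<subseteq> carrier (borel_full_group (orbit_relation \<Phi>))"
    and "0 < \<delta>"
  shows "\<exists>(A :: nat set) \<theta>. finite A \<and> A \<noteq> {} \<and> (\<forall>T\<in>I. \<theta> T \<in> A \<rightarrow>\<^sub>E A) \<and>
    (\<forall>S\<in>I. \<forall>T\<in>I. \<forall>U\<in>I. (AE x in cantor_measure. U x = S (T x)) \<longrightarrow>
      hamming_dist A (\<theta> U) (compose A (\<theta> S) (\<theta> T)) \<le> \<delta>) \<and>
    (\<forall>T\<in>I. hamming_dist A (\<theta> T) (\<lambda>x\<in>A. x) > measure cantor_measure {x. T x \<noteq> x} - \<delta>) \<and>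
    (id \<in> I \<longrightarrow> \<theta> id = (\<lambda>x\<in>A. x))"
proof -
  let ?\<mu> = "measure cantor_measure"
  have pmp: "pmp_action \<Phi>" using \<Phi> by (simp add: sofic_action_def)
  \<comment> \<open>In \<open>mult\<close> three exceptional sets of measure below \<eta> must
    together stay below \<delta>.\<close>
  define \<eta> where "\<eta> = \<delta> / 4"
  have \<eta>: "0 < \<eta>" "3 * \<eta> < \<delta>" "\<eta> < \<delta>" using \<open>0 < \<delta>\<close> by (auto simp: \<eta>_def)
  define ok where "ok T r r0 code \<longleftrightarrow> (\<forall>z. code z \<in> short_words r r0) \<and> (T = id \<longrightarrow> code = (\<lambda>_. [])) \<and>
    ?\<mu> {x. T x \<noteq> \<Phi> (code (restrict x {..<r})) x} < \<eta>" for T r r0 code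
  have "\<exists>r0. \<forall>r\<ge>r0. \<exists>code. ok T r r0 code" if "T \<in> I" for T
    unfolding ok_def using full_group_code[OF pmp _ \<eta>(1)] I that by blast
  then obtain r0 where r0: "\<And>T r. T \<in> I \<Longrightarrow> r0 T \<le> r \<Longrightarrow> \<exists>code. ok T r (r0 T) code"
    by metis
  \<comment> \<open>The sum dominates every \<open>r0 T\<close>; the successor secures
    \<open>r \<ge> 1\<close>, as soficity of the action demands.\<close>
  define r where "r = Suc (\<Sum>T\<in>I. r0 T)"
  have r0_le: "r0 T \<le> r" if "T \<in> I" for T
    using member_le_sum[OF that, of r0] I(1) by (simp add: r_def)
  then have "\<forall>T\<in>I. \<exists>code. ok T r (r0 T) code" using r0 by blast
  from bchoice[OF this] obtain code where ok: "\<And>T. T \<in> I \<Longrightarrow> ok T r (r0 T) (code T)"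
    by blast
  have code: "code T z \<in> short_words r r" if "T \<in> I" for T z
    using ok[OF that] short_words_mono[of r r "r0 T" r] r0_le[OF that] unfolding ok_def by blast
  \<comment> \<open>The word of \<open>S\<close> following the word of \<open>T\<close> has length
    at most \<open>2 * r\<close>.\<close>
  define k where "k = 2 * r"
  have rk: "r \<ge> 1" "k \<ge> 1" by (auto simp: r_def k_def)
  have code_k: "code T z \<in> short_words r k" if "T \<in> I" for T z
    using code[OF that] short_words_mono[of r r r k] by (auto simp: k_def)
  define \<rho> where "\<rho> x = restrict x {..<r}" for x :: "nat \<Rightarrow> bool"

  obtain Y :: "nat \<Rightarrow> nat set" and \<alpha> lab where Y: "\<And>n. finite (Y n)" "\<And>n. Y n \<noteq> {}"
    and act: "\<And>n. group_action (free_group_fin r) (Y n) (\<alpha> n)" and lab: "\<And>n. lab n \<in> Y n \<rightarrow> bit_labels r"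
    and lim: "\<And>\<kappa>. \<kappa> \<in> ball_classes r k \<Longrightarrow>
      (\<lambda>n. real (card {y \<in> Y n. iso_class (kball r k (\<alpha> n) (lab n) y) = \<kappa>}) / real (card (Y n)))
        \<longlonglongrightarrow> ?\<mu> {x. iso_class (kball r k \<Phi> \<rho> x) = \<kappa>}"
    using \<Phi> rk unfolding sofic_action_def \<rho>_def by meson
  have act\<Phi>: "group_action (free_group_fin r) UNIV \<Phi>"
    using pmp by (auto simp: pmp_action_def intro: group_action_free_group_mono)
  note ev = eventually_frequency[OF Y act lab root_in_kball[OF act\<Phi> UNIV_I]]

  \<comment> \<open>\<open>\<tau>\<close> and \<open>\<sigma>\<close> follow the same codes, one
    reading coordinates in \<open>X\<close> and the other labels in the finite action.\<close>
  define \<tau> where "\<tau> T x = \<Phi> (code T (\<rho> x)) x" for T x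
  define \<sigma> where "\<sigma> n T y = \<alpha> n (code T (lab n y)) y" for n T y
  have closed: "\<sigma> n T y \<in> Y n" if "T \<in> I" "y \<in> Y n" for n T y
    using group_action.element_image[OF act _ that(2)] code[OF that(1)]
    by (auto simp: \<sigma>_def short_words_def)
  \<comment> \<open>Isomorphic balls of radius \<open>k\<close> give the same answers: both sides of
    each equation are vertices named by short words, and the words are the same for \<open>x\<close>
    and \<open>y\<close>.\<close>
  have inv: "\<tau> U x = \<tau> S (\<tau> T x) \<longleftrightarrow> \<sigma> n U y = \<sigma> n S (\<sigma> n T y)" "\<tau> T x = x \<longleftrightarrow> \<sigma> n T y = y"
    if iso: "labeled_iso (kball r k \<Phi> \<rho> x) (kball r k (\<alpha> n) (lab n) y)"
      and STU: "S \<in> I" "T \<in> I" "U \<in> I" and y: "y \<in> Y n" for S T U n x y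
  proof -
    note D = labeled_iso_kballD[OF act\<Phi> UNIV_I act y iso]
    have Nil: "\<Phi> [] x = x" "\<alpha> n [] y = y" using group_action_Nil[OF act\<Phi>] group_action_Nil[OF act y] by auto
    have \<rho>: "\<rho> x = lab n y" using D(2)[of "[]"] by (simp add: Nil)
    \<comment> \<open>The labels also match where \<open>T\<close> leads, so \<open>S\<close>
      continues with the same word on both sides.\<close>
    have \<rho>': "\<rho> (\<tau> T x) = lab n (\<sigma> n T y)"
      using D(2)[OF code_k[OF STU(2)]] by (simp add: \<tau>_def \<sigma>_def \<rho>)
    show "\<tau> T x = x \<longleftrightarrow> \<sigma> n T y = y"
      using D(1)[OF code_k[OF STU(2)], of "[]" "lab n y"] by (simp add: \<tau>_def \<sigma>_def \<rho> Nil)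
    define s t where "s = code S (lab n (\<sigma> n T y))" and "t = code T (lab n y)"
    have st: "s \<in> short_words r r" "t \<in> short_words r r" using code STU by (auto simp: s_def t_def)
    then have car: "s \<in> carrier (free_group_fin r)" "t \<in> carrier (free_group_fin r)"
      by (auto simp: short_words_def)
    then have "foldr push s t \<in> carrier (free_group_fin r)"
      using monoid.m_closed[OF group.is_monoid[OF group_free_group], of s _ t] by (simp add: mult_free_group)
    moreover have "length (foldr push s t) \<le> k"
      using length_foldr_push[of s t] st by (simp add: short_words_def k_def)
    ultimately have "foldr push s t \<in> short_words r k" by (simp add: short_words_def)
    from D(1)[OF code_k[OF STU(3)] this, of "lab n y"]
    have "\<Phi> (code U (lab n y)) x = \<Phi> s (\<Phi> t x) \<longleftrightarrow> \<alpha> n (code U (lab n y)) y = \<alpha> n s (\<alpha> n t y)"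
      by (simp only: group_action_push[OF act\<Phi> UNIV_I car] group_action_push[OF act y car])
    moreover have "\<tau> U x = \<Phi> (code U (lab n y)) x" "\<tau> S (\<tau> T x) = \<Phi> s (\<Phi> t x)"
      using \<rho>' by (simp_all add: \<tau>_def \<rho> s_def t_def)
    moreover have "\<sigma> n U y = \<alpha> n (code U (lab n y)) y" "\<sigma> n S (\<sigma> n T y) = \<alpha> n s (\<alpha> n t y)"
      by (simp_all add: \<sigma>_def s_def t_def)
    ultimately show "\<tau> U x = \<tau> S (\<tau> T x) \<longleftrightarrow> \<sigma> n U y = \<sigma> n S (\<sigma> n T y)" by simp
  qed

  have \<tau>_meas: "\<tau> T \<in> measurable cantor_measure cantor_measure" if "T \<in> I" for T
    unfolding \<tau>_def \<rho>_def
    by (rule measurable_apply_code[OF pmp measurable_cantor_restrict])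
      (use code[OF that] short_words_carrier in auto)
  have T_meas: "T \<in> measurable cantor_measure cantor_measure" if "T \<in> I" for T
    using I that by (auto simp: borel_full_group_def)
  have id_meas: "(\<lambda>x. x) \<in> measurable cantor_measure cantor_measure" by simp
  define D where "D T = {x. T x \<noteq> \<tau> T x}" for T
  have D: "D T \<in> sets cantor_measure" "?\<mu> (D T) < \<eta>" if "T \<in> I" for T
    using sets_cantor_neq[OF T_meas \<tau>_meas] ok[OF that] that by (auto simp: D_def ok_def \<tau>_def \<rho>_def)

  have mult: "1 - \<delta> < ?\<mu> {x. \<tau> U x = \<tau> S (\<tau> T x)}"
    if STU: "S \<in> I" "T \<in> I" "U \<in> I" and AE: "AE x in cantor_measure. U x = S (T x)" for S T U
  proof -
    have ST: "(\<lambda>x. S (T x)) \<in> measurable cantor_measure cantor_measure"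
      "(\<lambda>x. \<tau> S (\<tau> T x)) \<in> measurable cantor_measure cantor_measure"
      using measurable_compose T_meas \<tau>_meas STU by blast+
    have Z: "{x. U x \<noteq> S (T x)} \<in> sets cantor_measure" by (rule sets_cantor_neq[OF T_meas[OF STU(3)] ST(1)])
    have Z0: "?\<mu> {x. U x \<noteq> S (T x)} = 0"
      using AE_iff_measurable[OF Z, of "\<lambda>x. U x = S (T x)"] AE by (simp add: measure_def)
    \<comment> \<open>\<open>S\<close> is replaced by its code at \<open>T x\<close>, so its error
      set is pulled back by \<open>T\<close>; invariance of the measure keeps the pullback
      small.\<close>
    have TD: "T -` D S \<in> sets cantor_measure"
      using measurable_sets[OF T_meas[OF STU(2)] D(1)[OF STU(1)]] by simp
    have "?\<mu> (T -` D S) = measure (distr cantor_measure cantor_measure T) (D S)"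
      using T_meas[OF STU(2)] D(1)[OF STU(1)] by (simp add: measure_distr)
    also have "\<dots> = ?\<mu> (D S)"
      using full_group_preserves_measure[OF pmp] I STU by (metis subsetD)
    finally have TD': "?\<mu> (T -` D S) < \<eta>" using D(2)[OF STU(1)] by simp
    have "{x. \<tau> U x \<noteq> \<tau> S (\<tau> T x)} \<subseteq> D U \<union> D T \<union> T -` D S \<union> {x. U x \<noteq> S (T x)}"
    proof (rule subsetI, rule ccontr)
      fix x assume x: "x \<in> {x. \<tau> U x \<noteq> \<tau> S (\<tau> T x)}" "x \<notin> D U \<union> D T \<union> T -` D S \<union> {x. U x \<noteq> S (T x)}"
      then have "U x = \<tau> U x" "T x = \<tau> T x" "S (T x) = \<tau> S (T x)" "U x = S (T x)"
        by (auto simp: D_def)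
      with x(1) show False by simp
    qed
    then have "?\<mu> {x. \<tau> U x \<noteq> \<tau> S (\<tau> T x)} \<le> ?\<mu> (D U \<union> D T \<union> T -` D S \<union> {x. U x \<noteq> S (T x)})"
      using D STU TD Z by (intro cantor.finite_measure_mono) auto
    also have "\<dots> \<le> ?\<mu> (D U \<union> D T \<union> T -` D S) + ?\<mu> {x. U x \<noteq> S (T x)}"
      using D STU TD Z by (intro measure_Un_le) auto
    also have "?\<mu> (D U \<union> D T \<union> T -` D S) \<le> ?\<mu> (D U \<union> D T) + ?\<mu> (T -` D S)"
      using D STU TD by (intro measure_Un_le) auto
    also have "?\<mu> (D U \<union> D T) \<le> ?\<mu> (D U) + ?\<mu> (D T)"
      using D STU by (intro measure_Un_le) auto
    finally have "?\<mu> {x. \<tau> U x \<noteq> \<tau> S (\<tau> T x)} < \<delta>"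
      using D(2)[OF STU(2)] D(2)[OF STU(3)] TD' Z0 \<eta>(2) by simp
    moreover have "?\<mu> (space cantor_measure - {x. \<tau> U x = \<tau> S (\<tau> T x)}) = 1 - ?\<mu> {x. \<tau> U x = \<tau> S (\<tau> T x)}"
      by (rule cantor.prob_compl[OF sets_cantor_eq[OF \<tau>_meas[OF STU(3)] ST(2)]])
    moreover have "space cantor_measure - {x. \<tau> U x = \<tau> S (\<tau> T x)} = {x. \<tau> U x \<noteq> \<tau> S (\<tau> T x)}" by auto
    ultimately show ?thesis by simp
  qed
  have sep: "?\<mu> {x. T x \<noteq> x} - \<delta> < ?\<mu> {x. \<tau> T x \<noteq> x}" if T: "T \<in> I" for T
  proof -
    have s: "{x. \<tau> T x \<noteq> x} \<in> sets cantor_measure"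
      by (rule sets_cantor_neq[OF \<tau>_meas[OF T] id_meas])
    have "?\<mu> {x. T x \<noteq> x} \<le> ?\<mu> ({x. \<tau> T x \<noteq> x} \<union> D T)"
      using s D(1)[OF T] by (intro cantor.finite_measure_mono) (auto simp: D_def)
    also have "\<dots> \<le> ?\<mu> {x. \<tau> T x \<noteq> x} + ?\<mu> (D T)"
      using s D(1)[OF T] by (intro measure_Un_le) auto
    finally show ?thesis using D(2)[OF T] \<eta>(3) by simp
  qed

  \<comment> \<open>Since \<open>I\<close> is finite, only finitely many frequency bounds are
    required, and a single \<open>n\<close> satisfies them all.\<close>
  have "eventually (\<lambda>n. \<forall>(S, T, U) \<in> {(S, T, U) \<in> I \<times> I \<times> I. AE x in cantor_measure. U x = S (T x)}.
      1 - \<delta> < real (card {y \<in> Y n. \<sigma> n U y = \<sigma> n S (\<sigma> n T y)}) / real (card (Y n))) sequentially"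
  proof (rule eventually_ball_finite)
    show "finite {(S, T, U) \<in> I \<times> I \<times> I. AE x in cantor_measure. U x = S (T x)}"
      by (rule finite_subset[of _ "I \<times> I \<times> I"]) (use I in auto)
    have "eventually (\<lambda>n. 1 - \<delta> < real (card {y \<in> Y n. \<sigma> n U y = \<sigma> n S (\<sigma> n T y)}) / real (card (Y n))) sequentially"
      if STU: "S \<in> I" "T \<in> I" "U \<in> I" and AE: "AE x in cantor_measure. U x = S (T x)" for S T U
    proof (rule ev[where P = "\<lambda>x. \<tau> U x = \<tau> S (\<tau> T x)" and Q = "\<lambda>n y. \<sigma> n U y = \<sigma> n S (\<sigma> n T y)",
        OF _ _ _ mult[OF STU AE]])
      show "{x. \<tau> U x = \<tau> S (\<tau> T x)} \<in> sets cantor_measure"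
        by (rule sets_cantor_eq[OF \<tau>_meas[OF STU(3)] measurable_compose[OF \<tau>_meas[OF STU(2)] \<tau>_meas[OF STU(1)]]])
    qed (rule lim, assumption, use inv(1)[OF _ STU] in blast)
    then show "\<forall>p\<in>{(S, T, U) \<in> I \<times> I \<times> I. AE x in cantor_measure. U x = S (T x)}.
      eventually (\<lambda>n. case p of (S, T, U) \<Rightarrow>
        1 - \<delta> < real (card {y \<in> Y n. \<sigma> n U y = \<sigma> n S (\<sigma> n T y)}) / real (card (Y n))) sequentially"
      by auto
  qed
  moreover have "eventually (\<lambda>n. \<forall>T\<in>I. ?\<mu> {x. T x \<noteq> x} - \<delta> <
      real (card {y \<in> Y n. \<sigma> n T y \<noteq> y}) / real (card (Y n))) sequentially"
  proof (rule eventually_ball_finite[OF I(1)], rule ballI)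
    fix T assume T: "T \<in> I"
    show "eventually (\<lambda>n. ?\<mu> {x. T x \<noteq> x} - \<delta> <
      real (card {y \<in> Y n. \<sigma> n T y \<noteq> y}) / real (card (Y n))) sequentially"
    proof (rule ev[where P = "\<lambda>x. \<tau> T x \<noteq> x" and Q = "\<lambda>n y. \<sigma> n T y \<noteq> y", OF _ _ _ sep[OF T]])
      show "{x. \<tau> T x \<noteq> x} \<in> sets cantor_measure"
        by (rule sets_cantor_neq[OF \<tau>_meas[OF T] id_meas])
    qed (rule lim, assumption, use inv(2)[OF _ T T T] in blast)
  qed
  ultimately have "eventually (\<lambda>n.
     (\<forall>(S, T, U) \<in> {(S, T, U) \<in> I \<times> I \<times> I. AE x in cantor_measure. U x = S (T x)}.
      1 - \<delta> < real (card {y \<in> Y n. \<sigma> n U y = \<sigma> n S (\<sigma> n T y)}) / real (card (Y n))) \<and>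
     (\<forall>T\<in>I. ?\<mu> {x. T x \<noteq> x} - \<delta> < real (card {y \<in> Y n. \<sigma> n T y \<noteq> y}) / real (card (Y n)))) sequentially"
    by (rule eventually_conj)
  then obtain n where
    n1: "\<And>S T U. S \<in> I \<Longrightarrow> T \<in> I \<Longrightarrow> U \<in> I \<Longrightarrow> AE x in cantor_measure. U x = S (T x) \<Longrightarrow>
      1 - \<delta> < real (card {y \<in> Y n. \<sigma> n U y = \<sigma> n S (\<sigma> n T y)}) / real (card (Y n))"
    and n2: "\<And>T. T \<in> I \<Longrightarrow> ?\<mu> {x. T x \<noteq> x} - \<delta> < real (card {y \<in> Y n. \<sigma> n T y \<noteq> y}) / real (card (Y n))"
    using eventually_happens'[OF sequentially_bot] by blast
  show ?thesis
  proof (intro exI[of _ "Y n"] exI[of _ "\<lambda>T. \<lambda>y\<in>Y n. \<sigma> n T y"] conjI ballI impI)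
    fix S T U assume STU: "S \<in> I" "T \<in> I" "U \<in> I" "AE x in cantor_measure. U x = S (T x)"
    have "hamming_dist (Y n) (\<lambda>y\<in>Y n. \<sigma> n U y) (compose (Y n) (\<lambda>y\<in>Y n. \<sigma> n S y) (\<lambda>y\<in>Y n. \<sigma> n T y)) =
        hamming_dist (Y n) (\<sigma> n U) (\<lambda>y. \<sigma> n S (\<sigma> n T y))"
      using closed STU by (intro hamming_dist_cong) (auto simp: compose_def)
    also have "\<dots> = 1 - real (card {y \<in> Y n. \<sigma> n U y = \<sigma> n S (\<sigma> n T y)}) / real (card (Y n))"
      by (rule hamming_dist_agree[OF Y])
    also have "\<dots> \<le> \<delta>" using n1[OF STU] by simp
    finally show "hamming_dist (Y n) (\<lambda>y\<in>Y n. \<sigma> n U y)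
        (compose (Y n) (\<lambda>y\<in>Y n. \<sigma> n S y) (\<lambda>y\<in>Y n. \<sigma> n T y)) \<le> \<delta>" .
  next
    fix T assume T: "T \<in> I"
    have "hamming_dist (Y n) (\<lambda>y\<in>Y n. \<sigma> n T y) (\<lambda>y\<in>Y n. y) = hamming_dist (Y n) (\<sigma> n T) (\<lambda>y. y)"
      by (intro hamming_dist_cong) auto
    moreover have "\<dots> > ?\<mu> {x. T x \<noteq> x} - \<delta>"
      using n2[OF T] by (simp add: hamming_dist_def)
    ultimately show "hamming_dist (Y n) (\<lambda>y\<in>Y n. \<sigma> n T y) (\<lambda>y\<in>Y n. y) > ?\<mu> {x. T x \<noteq> x} - \<delta>"
      by simp
  next
    assume "id \<in> I"
    then have "code id = (\<lambda>_. [])" using ok by (simp add: ok_def)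
    then show "(\<lambda>y\<in>Y n. \<sigma> n id y) = (\<lambda>y\<in>Y n. y)"
      using group_action_Nil[OF act] by (auto simp: \<sigma>_def intro!: restrict_ext)
  qed (use Y closed in auto)
qed

theorem theorem1:
  fixes E :: "((nat \<Rightarrow> bool) \<times> (nat \<Rightarrow> bool)) set"
  assumes "sofic_relation E"
  shows "sofic_group (full_group E)"
proof -
  obtain \<Phi> where \<Phi>: "sofic_action \<Phi>" and E: "E = orbit_relation \<Phi>"
    using assms by (auto simp: sofic_relation_def)
  have pmp: "pmp_action \<Phi>" using \<Phi> by (simp add: sofic_action_def)
  let ?G = "borel_full_group E" and ?N = "ae_trivial E" and ?\<mu> = "measure cantor_measure"
  interpret normal ?N ?G unfolding E by (rule normal_ae_trivial[OF pmp])
  \<comment> \<open>The trivial coset is represented by \<open>id\<close> itself and not by an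
    arbitrary almost everywhere trivial map, so that its model is exactly the identity.\<close>
  define rep where "rep f = (if f = ?N then id else SOME T. T \<in> carrier ?G \<and> f = ?N #>\<^bsub>?G\<^esub> T)" for f
  have rep: "rep f \<in> carrier ?G" "f = ?N #>\<^bsub>?G\<^esub> rep f" if "f \<in> carrier (full_group E)" for f
  proof -
    have "rep f \<in> carrier ?G \<and> f = ?N #>\<^bsub>?G\<^esub> rep f"
    proof (cases "f = ?N")
      case True
      then show ?thesis
        using one_closed coset_mult_one[OF subset] by (simp add: rep_def borel_full_group_simps)
    next
      case False
      from that have "\<exists>T. T \<in> carrier ?G \<and> f = ?N #>\<^bsub>?G\<^esub> T"
        by (auto simp: full_group_def carrier_FactGroup)
      from someI_ex[OF this] show ?thesis using False by (simp add: rep_def)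
    qed
    then show "rep f \<in> carrier ?G" "f = ?N #>\<^bsub>?G\<^esub> rep f" by auto
  qed
  have rep_mult: "AE x in cantor_measure. rep (f \<otimes>\<^bsub>full_group E\<^esub> g) x = rep f (rep g x)"
    if fg: "f \<in> carrier (full_group E)" "g \<in> carrier (full_group E)"
      "f \<otimes>\<^bsub>full_group E\<^esub> g \<in> carrier (full_group E)" for f g
  proof -
    let ?h = "f \<otimes>\<^bsub>full_group E\<^esub> g"
    have c: "rep f \<circ> rep g \<in> carrier ?G"
      using m_closed[OF rep(1)[OF fg(1)] rep(1)[OF fg(2)]] by (simp add: borel_full_group_simps)
    have "?h = ?N #>\<^bsub>?G\<^esub> (rep f \<otimes>\<^bsub>?G\<^esub> rep g)"
      using rcos_sum[OF rep(1)[OF fg(1)] rep(1)[OF fg(2)]] rep(2)[OF fg(1)] rep(2)[OF fg(2)]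
      by (simp add: full_group_def)
    moreover have "rep ?h \<in> ?h"
      using rep[OF fg(3)] rcos_self[OF rep(1)[OF fg(3)]] is_subgroup by metis
    ultimately have "rep ?h \<in> ?N #>\<^bsub>?G\<^esub> (rep f \<circ> rep g)"
      by (simp add: borel_full_group_simps)
    \<comment> \<open>Representatives multiply up to a factor \<open>S\<close> that is trivial
      almost everywhere; evaluating it at the image under \<open>rep f \<circ> rep g\<close> again
      needs invariance of the measure.\<close>
    then obtain S where S: "S \<in> ?N" "rep ?h = S \<circ> (rep f \<circ> rep g)"
      by (auto simp: r_coset_def borel_full_group_simps)
    have "AE x in cantor_measure. S x = x" using S(1) unfolding ae_trivial_def by blast
    then have "AE x in cantor_measure. S ((rep f \<circ> rep g) x) = (rep f \<circ> rep g) x"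
      by (rule full_group_AE[OF pmp c[unfolded E]])
    then show ?thesis by (simp only: S(2) o_apply)
  qed
  \<comment> \<open>A Borel map other than \<open>id\<close> may have null support; passing to
    cosets excludes this and makes a positive bound possible.\<close>
  have rep_ne: "0 < ?\<mu> {x. rep f x \<noteq> x}" if f: "f \<in> carrier (full_group E)" "f \<noteq> \<one>\<^bsub>full_group E\<^esub>" for f
  proof (rule ccontr)
    assume "\<not> ?thesis"
    then have z: "?\<mu> {x. rep f x \<noteq> x} = 0" by (simp add: zero_less_measure_iff)
    have m: "rep f \<in> measurable cantor_measure cantor_measure"
      using rep(1)[OF f(1)] by (simp add: borel_full_group_def)
    have "{x. rep f x \<noteq> x} \<in> sets cantor_measure" by (rule sets_cantor_neq[OF m]) simp
    then have "AE x in cantor_measure. rep f x = x"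
      using z AE_iff_measurable[of "{x. rep f x \<noteq> x}" cantor_measure "\<lambda>x. rep f x = x"]
      by (simp add: cantor.emeasure_eq_measure)
    then have "rep f \<in> ?N" using rep(1)[OF f(1)] unfolding ae_trivial_def by blast
    from coset_join2[OF rep(1)[OF f(1)] is_subgroup this] have "f = ?N"
      using rep(2)[OF f(1)] by metis
    with f(2) show False by (simp add: full_group_def)
  qed
  show ?thesis
  proof (rule sofic_group_amplify)
    show group: "group (full_group E)" unfolding full_group_def by (rule factorgroup_is_group)
    fix F assume F: "finite F" "F \<subseteq> carrier (full_group E)"
    \<comment> \<open>The inserted \<open>1\<close> gives the minimum a meaning when
      \<open>F\<close> has no nontrivial element. Halving leaves room for the loss: supports have
      measure at least \<open>2 * c\<close>, and \<delta> will be at most \<open>c\<close>.\<close>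
    define c where "c = Min (insert 1 ((\<lambda>f. ?\<mu> {x. rep f x \<noteq> x}) ` (F - {\<one>\<^bsub>full_group E\<^esub>}))) / 2"
    have "c > 0" unfolding c_def using F rep_ne by auto
    have c: "2 * c \<le> ?\<mu> {x. rep f x \<noteq> x}" if "f \<in> F" "f \<noteq> \<one>\<^bsub>full_group E\<^esub>" for f
      unfolding c_def using F that by (auto intro!: Min_le)
    show "\<exists>c>0. \<forall>\<epsilon>>0. \<exists>(A :: nat set) \<Theta>. finite A \<and> A \<noteq> {} \<and> \<Theta> \<in> carrier (full_group E) \<rightarrow> (A \<rightarrow>\<^sub>E A) \<and>
        (\<forall>f\<in>F. \<forall>g\<in>F. f \<otimes>\<^bsub>full_group E\<^esub> g \<in> F \<longrightarrow>
            hamming_dist A (\<Theta> (f \<otimes>\<^bsub>full_group E\<^esub> g)) (compose A (\<Theta> f) (\<Theta> g)) \<le> \<epsilon>) \<and>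
        (\<forall>f\<in>F. f \<noteq> \<one>\<^bsub>full_group E\<^esub> \<longrightarrow> hamming_dist A (\<Theta> f) (\<lambda>x\<in>A. x) > c) \<and>
        \<Theta> \<one>\<^bsub>full_group E\<^esub> = (\<lambda>x\<in>A. x)"
    proof (intro exI[of _ c] conjI allI impI \<open>c > 0\<close>)
      fix \<epsilon> :: real assume "\<epsilon> > 0"
      define \<delta> where "\<delta> = min \<epsilon> c"
      have \<delta>: "0 < \<delta>" "\<delta> \<le> \<epsilon>" "\<delta> \<le> c" using \<open>\<epsilon> > 0\<close> \<open>c > 0\<close> by (auto simp: \<delta>_def)
      have I: "finite (rep ` F)" "rep ` F \<subseteq> carrier (borel_full_group (orbit_relation \<Phi>))"
        using F rep(1) by (auto simp flip: E)
      obtain A :: "nat set" and \<theta> where A: "finite A" "A \<noteq> {}"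
        and \<theta>: "\<forall>T\<in>rep ` F. \<theta> T \<in> A \<rightarrow>\<^sub>E A"
        and mult: "\<forall>S\<in>rep ` F. \<forall>T\<in>rep ` F. \<forall>U\<in>rep ` F. (AE x in cantor_measure. U x = S (T x)) \<longrightarrow>
          hamming_dist A (\<theta> U) (compose A (\<theta> S) (\<theta> T)) \<le> \<delta>"
        and sep: "\<forall>T\<in>rep ` F. hamming_dist A (\<theta> T) (\<lambda>x\<in>A. x) > ?\<mu> {x. T x \<noteq> x} - \<delta>"
        and one: "id \<in> rep ` F \<longrightarrow> \<theta> id = (\<lambda>x\<in>A. x)"
        using sofic_approximation[OF \<Phi> I \<delta>(1)] by (elim exE conjE) (rule that)
      \<comment> \<open>The identity outside \<open>F\<close> also gives the required value at the
        unit when \<open>F\<close> does not contain it.\<close>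
      define \<Theta> where "\<Theta> f = (if f \<in> F then \<theta> (rep f) else (\<lambda>x\<in>A. x))" for f
      have rep1: "rep \<one>\<^bsub>full_group E\<^esub> = id" by (simp add: rep_def full_group_def)
      show "\<exists>(A :: nat set) \<Theta>. finite A \<and> A \<noteq> {} \<and> \<Theta> \<in> carrier (full_group E) \<rightarrow> (A \<rightarrow>\<^sub>E A) \<and>
        (\<forall>f\<in>F. \<forall>g\<in>F. f \<otimes>\<^bsub>full_group E\<^esub> g \<in> F \<longrightarrow>
            hamming_dist A (\<Theta> (f \<otimes>\<^bsub>full_group E\<^esub> g)) (compose A (\<Theta> f) (\<Theta> g)) \<le> \<epsilon>) \<and>
        (\<forall>f\<in>F. f \<noteq> \<one>\<^bsub>full_group E\<^esub> \<longrightarrow> hamming_dist A (\<Theta> f) (\<lambda>x\<in>A. x) > c) \<and>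
        \<Theta> \<one>\<^bsub>full_group E\<^esub> = (\<lambda>x\<in>A. x)"
      proof (intro exI[of _ A] exI[of _ \<Theta>] conjI ballI impI A)
        show "\<Theta> \<in> carrier (full_group E) \<rightarrow> (A \<rightarrow>\<^sub>E A)"
          using \<theta> by (auto simp: \<Theta>_def)
      next
        fix f g assume fg: "f \<in> F" "g \<in> F" "f \<otimes>\<^bsub>full_group E\<^esub> g \<in> F"
        have "AE x in cantor_measure. rep (f \<otimes>\<^bsub>full_group E\<^esub> g) x = rep f (rep g x)"
          using fg F by (intro rep_mult) auto
        with mult fg have "hamming_dist A (\<theta> (rep (f \<otimes>\<^bsub>full_group E\<^esub> g)))
            (compose A (\<theta> (rep f)) (\<theta> (rep g))) \<le> \<delta>" by blast
        with \<delta>(2) show "hamming_dist A (\<Theta> (f \<otimes>\<^bsub>full_group E\<^esub> g)) (compose A (\<Theta> f) (\<Theta> g)) \<le> \<epsilon>"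
          by (simp add: \<Theta>_def fg)
      next
        fix f assume f: "f \<in> F" "f \<noteq> \<one>\<^bsub>full_group E\<^esub>"
        then show "hamming_dist A (\<Theta> f) (\<lambda>x\<in>A. x) > c"
          using bspec[OF sep, of "rep f"] c[OF f] \<delta>(3) by (simp add: \<Theta>_def)
      next
        show "\<Theta> \<one>\<^bsub>full_group E\<^esub> = (\<lambda>x\<in>A. x)"
        proof (cases "\<one>\<^bsub>full_group E\<^esub> \<in> F")
          case True
          then have "id \<in> rep ` F" using rep1 by (metis imageI)
          with one rep1 True show ?thesis by (simp add: \<Theta>_def)
        qed (simp add: \<Theta>_def)
      qed
    qed
  qed
qed

end
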